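(* Let $a,b,c\in\mathbb{R}$, $1\le p<\infty$ and $0<q,r<\infty$. Then $W^{1,(q,p)}_{\{a,b\}}(\mathbb{R}^N_* )$ (and hence also $\widetilde W^{1,(q,p)}_{\{a,b\}}$) is not contained in $L^r(\mathbb{R}^N;|x|^c dx)$ if: (i) $c$ does not belong to the closed interval with endpoints $c^0$ and $c^1$; or (ii) ($b-p\le -N<a$ or $b-p\ge -N>a$) and $c$ does not belong to the interval with endpoints $c^0$ (included) and $-N$ (not included). Furthermore, $W^{1,(q,p)}_{\{a,b\}}(\mathbb{R}^N_* )$ (and hence also $\widetilde W^{1,(q,p)}_{\{a,b\}}$) is not continuously embedded into $L^r(\mathbb{R}^N;|x|^c dx)$ if: (iii) $\frac{a+N}{q}\ne\frac{b-p+N}{p}$, $c=c^0$ and $r\ne q$; or (iv) $\frac{a+N}{q}\ne\frac{b-p+N}{p}$, $c=c^1$ and $r<p$; or (v) $\frac{a+N}{q}=\frac{b-p+N}{p}$, $r<\min\{p,q\}$ and $c=c^0$; or (vi) $a=-N$, $b=p-N$, $r<q$ and $c=c^0$.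
   Context: $N\ge1$, $\mathbb{R}^N_*:=\mathbb{R}^N\setminus\{0\}$. For $d\in\mathbb{R}$, $0<s<\infty$, $\|u\|_{d,s}:=(\int_{\mathbb{R}^N}|x|^d|u|^s dx)^{1/s}$ and $L^s(\mathbb{R}^N;|x|^ddx)$ is the set of measurable $u$ with $\|u\|_{d,s}<\infty$ ($\{0\}$ has measure $0$). $W^{1,(q,p)}_{\{a,b\}}(\mathbb{R}^N_* )$ is the set of $u\in L^1_{loc}(\mathbb{R}^N_* )$ with $\|u\|_{a,q}<\infty$ and $\|\nabla u\|_{b,p}<\infty$ ($\nabla u$ the distributional gradient on $\mathbb{R}^N_*$), with (quasi-)norm $\|u\|_{a,q}+\|\nabla u\|_{b,p}$. For a distribution $u$ on $\mathbb{R}^N_*$, $\partial_\rho u:=\nabla u\cdot\frac{x}{|x|}$; $\widetilde W^{1,(q,p)}_{\{a,b\}}$ is the set of $u\in L^1_{loc}(\mathbb{R}^N_* )$ with $\|u\|_{a,q}<\infty$ and $\|\partial_\rho u\|_{b,p}<\infty$, with (quasi-)norm $\|u\|_{a,q}+\|\partial_\rho u\|_{b,p}$. $c^0:=\frac{r(a+N)}{q}-N$, $c^1:=\frac{r(b-p+N)}{p}-N$. *)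

theory Defs
  imports "HOL-Analysis.Analysis"
begin

definition smooth_fun :: "('a::euclidean_space \<Rightarrow> real) \<Rightarrow> bool" where
  "smooth_fun f \<longleftrightarrow> (\<exists>F. f \<in> F \<and>
     (\<forall>h\<in>F. (\<forall>x. h differentiable (at x)) \<and>
             (\<forall>i\<in>Basis. (\<lambda>x. frechet_derivative h (at x) i) \<in> F)))"

definition test_fun :: "('a::euclidean_space \<Rightarrow> real) \<Rightarrow> bool" where
  "test_fun \<phi> \<longleftrightarrow> smooth_fun \<phi> \<and> compact (closure {x. \<phi> x \<noteq> 0})
       \<and> 0 \<notin> closure {x. \<phi> x \<noteq> 0}"

definition grad :: "('a::euclidean_space \<Rightarrow> real) \<Rightarrow> 'a \<Rightarrow> 'a" where
  "grad \<phi> x = (\<Sum>i\<in>Basis. frechet_derivative \<phi> (at x) i *\<^sub>R i)"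

definition loc_int_star :: "('a::euclidean_space \<Rightarrow> 'b::{banach,second_countable_topology}) \<Rightarrow> bool" where
  "loc_int_star u \<longleftrightarrow> (\<forall>K. compact K \<and> 0 \<notin> K \<longrightarrow> set_integrable lebesgue K u)"

definition weak_grad :: "('a::euclidean_space \<Rightarrow> real) \<Rightarrow> ('a \<Rightarrow> 'a) \<Rightarrow> bool" where
  "weak_grad u g \<longleftrightarrow> loc_int_star u \<and> loc_int_star g \<and>
     (\<forall>\<phi>. test_fun \<phi> \<longrightarrow>
        (LINT x|lebesgue. u x *\<^sub>R grad \<phi> x) = - (LINT x|lebesgue. \<phi> x *\<^sub>R g x))"

text \<open>h is the distributional radial derivative of u, i.e. the distribution
  \<nabla>u \<cdot> x/|x| on R^N minus the origin:
  <\<partial>_\<rho> u, \<phi>> = \<Sum>_i <\<partial>_i u, \<phi> x_i/|x|> = - \<Sum>_i \<integral> u \<partial>_i(\<phi> x_i/|x|).\<close>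
definition weak_radial :: "('a::euclidean_space \<Rightarrow> real) \<Rightarrow> ('a \<Rightarrow> real) \<Rightarrow> bool" where
  "weak_radial u h \<longleftrightarrow> loc_int_star u \<and> loc_int_star h \<and>
     (\<forall>\<phi>. test_fun \<phi> \<longrightarrow>
        (LINT x|lebesgue. u x * (\<Sum>i\<in>Basis.
            frechet_derivative (\<lambda>y. \<phi> y * (y \<bullet> i) / norm y) (at x) i))
        = - (LINT x|lebesgue. h x * \<phi> x))"

definition wint :: "real \<Rightarrow> real \<Rightarrow> ('a::euclidean_space \<Rightarrow> 'b::real_normed_vector) \<Rightarrow> ennreal" where
  "wint d s u = (\<integral>\<^sup>+ x. ennreal (norm x powr d * norm (u x) powr s) \<partial>lebesgue)"

definition inL :: "real \<Rightarrow> real \<Rightarrow> ('a::euclidean_space \<Rightarrow> 'b::real_normed_vector) \<Rightarrow> bool" where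
  "inL d s u \<longleftrightarrow> u \<in> borel_measurable lebesgue \<and> wint d s u < \<infinity>"

text \<open>||u||_{d,s} (meaningful when inL d s u).\<close>
definition wnorm :: "real \<Rightarrow> real \<Rightarrow> ('a::euclidean_space \<Rightarrow> 'b::real_normed_vector) \<Rightarrow> real" where
  "wnorm d s u = enn2real (wint d s u) powr (1 / s)"

definition Lset :: "real \<Rightarrow> real \<Rightarrow> ('a::euclidean_space \<Rightarrow> real) set" where
  "Lset d s = {u. inL d s u}"

definition Wsp :: "real \<Rightarrow> real \<Rightarrow> real \<Rightarrow> real \<Rightarrow> ('a::euclidean_space \<Rightarrow> real) set" where
  "Wsp a b q p = {u. loc_int_star u \<and> inL a q u \<and> (\<exists>g. weak_grad u g \<and> inL b p g)}"

definition Wtsp :: "real \<Rightarrow> real \<Rightarrow> real \<Rightarrow> real \<Rightarrow> ('a::euclidean_space \<Rightarrow> real) set" where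
  "Wtsp a b q p = {u. loc_int_star u \<and> inL a q u \<and> (\<exists>h. weak_radial u h \<and> inL b p h)}"

definition emb_W :: "('a::euclidean_space) itself \<Rightarrow> real \<Rightarrow> real \<Rightarrow> real \<Rightarrow> real \<Rightarrow> real \<Rightarrow> real \<Rightarrow> bool" where
  "emb_W _ a b q p c r \<longleftrightarrow> (\<exists>C. \<forall>(u::'a \<Rightarrow> real) g.
      loc_int_star u \<and> inL a q u \<and> weak_grad u g \<and> inL b p g \<longrightarrow>
      inL c r u \<and> wnorm c r u \<le> C * (wnorm a q u + wnorm b p g))"

definition emb_Wt :: "('a::euclidean_space) itself \<Rightarrow> real \<Rightarrow> real \<Rightarrow> real \<Rightarrow> real \<Rightarrow> real \<Rightarrow> real \<Rightarrow> bool" where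
  "emb_Wt _ a b q p c r \<longleftrightarrow> (\<exists>C. \<forall>(u::'a \<Rightarrow> real) h.
      loc_int_star u \<and> inL a q u \<and> weak_radial u h \<and> inL b p h \<longrightarrow>
      inL c r u \<and> wnorm c r u \<le> C * (wnorm a q u + wnorm b p h))"

end

(* For u(x) = v(ln |x|) every weighted norm becomes a one-dimensional integral with exponential
   weight: up to the common factor |S^(N-1)|, the q-th power of the norm of u is the integral of
   e^((a+N) t) |v|^q, and the p-th power of the norm of its (radial or full) gradient is the
   integral of e^((b-p+N) t) |v'|^p.  For (i) and (ii), v is e^(-m t) times a smooth step on a
   half-line, with m = (c+N)/r or m = 0.  For (iii)-(vi), v is e^(-m t) times a bump of width L
   centred at tau: a term whose exponent is not critical is removed by sending tau to plus or minus
   infinity, and the remaining inequality between powers of L fails as L tends to 0 or infinity. *)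

theory Submission
  imports Defs
begin

text \<open>The choice m = (c+N)/r cancels the weight of the target norm: e^((c+N) t) |e^(-m t) w|^r
  = |w|^r. The two source norms are left with the exponents a+N-mq and b-p+N-mp, whose signs tell on
  which side of \<open>c0\<close> and \<open>c1\<close> the number c lies; an exponent is critical
  when it is 0. The end t = -infinity of a profile is the origin of R^N, the end t = +infinity is
  infinity, and a shift by tau is a dilation. The value m = 0 serves (ii): the derivative of a step
  has compact support, so its norm is finite whatever b is. The full gradient and the radial
  derivative of a radial function have the same modulus, so every profile settles both spaces at
  once. Profiles of class C^1 suffice, since weak derivatives are tested only on functions that
  vanish near the origin. In (iii)-(vi) the contradiction comes from one constant having to serve
  all L and tau.\<close>

section \<open>Radial integrals in the variable ln |x|\<close>

lemma nn_integral_exp_Ici: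
  fixes k t :: real
  assumes "k > 0"
  shows "(\<integral>\<^sup>+s. ennreal (exp (- k * s)) * indicator {t..} s \<partial>lborel) = ennreal (exp (- k * t) / k)"
proof -
  have "((\<lambda>s. - exp (- k * s) / k) \<longlongrightarrow> 0) at_top"
  proof -
    have "filterlim (\<lambda>s. - k * s) at_bot at_top"
      using assms by (intro filterlim_tendsto_neg_mult_at_bot[OF tendsto_const _ filterlim_ident]) auto
    then have "((\<lambda>s. - exp (- k * s) / k) \<longlongrightarrow> - 0 / k) at_top"
      by (intro tendsto_intros filterlim_compose[OF exp_at_bot]) (use assms in auto)
    then show ?thesis by simp
  qed
  moreover have "((\<lambda>s. - exp (- k * s) / k) has_real_derivative exp (- k * s)) (at s)" for s
    using assms by (auto intro!: derivative_eq_intros)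
  ultimately show ?thesis
    using nn_integral_FTC_atLeast[where F = "\<lambda>s. - exp (- k * s) / k" and f = "\<lambda>s. exp (- k * s)"
        and a = t and T = 0]
    by simp
qed

lemma nn_integral_exp_Iic:
  fixes k t :: real
  assumes "k > 0"
  shows "(\<integral>\<^sup>+s. ennreal (exp (k * s)) * indicator {..t} s \<partial>lborel) = ennreal (exp (k * t) / k)"
proof -
  have "(\<integral>\<^sup>+s. ennreal (exp (k * s)) * indicator {..t} s \<partial>lborel)
      = (\<integral>\<^sup>+s. ennreal (exp (- k * s)) * indicator {- t..} s \<partial>lborel)"
    by (subst nn_integral_real_affine[where c = "-1" and t = 0])
       (auto intro!: nn_integral_cong simp: indicator_def)
  then show ?thesis
    using nn_integral_exp_Ici[OF assms, of "- t"] by simp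
qed

text \<open>The surface measure of the unit sphere, in the form that differentiating the volume of a
  ball produces.\<close>

definition radial_const :: "'a::euclidean_space itself \<Rightarrow> real" where
  "radial_const _ = real DIM('a) * unit_ball_vol (real DIM('a))"

lemma radial_const_pos: "radial_const TYPE('a::euclidean_space) > 0"
  by (simp add: radial_const_def)

text \<open>The preimage of a half-line {..t} is a ball of radius e^t, whose volume V e^(N t) is the
  integral of N V e^(N s) over s \<le> t. Half-lines form an intersection-stable generator, so
  agreement on them is enough; this replaces polar coordinates.\<close>

lemma distr_ln_norm:
  "distr lborel borel (\<lambda>x::'a::euclidean_space. ln (norm x))
   = density lborel (\<lambda>t. ennreal (radial_const TYPE('a) * exp (real DIM('a) * t)))"
proof (rule measure_eqI_generator_eq[where E = "range atMost" and \<Omega> = UNIV and A = "\<lambda>n. {..real n}"])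
  let ?N = "real DIM('a)" and ?V = "unit_ball_vol (real DIM('a))"
  have N: "?N > 0" by simp
  have E: "emeasure (distr lborel borel (\<lambda>x::'a. ln (norm x))) {..t} = ennreal (?V * exp (?N * t))" for t
  proof -
    have "emeasure (distr lborel borel (\<lambda>x::'a. ln (norm x))) {..t}
        = emeasure lborel ((\<lambda>x::'a. ln (norm x)) -` {..t})"
      by (subst emeasure_distr) auto
    also have "\<dots> = emeasure lborel (cball (0::'a) (exp t))"
    proof (rule emeasure_eq_AE)
      \<comment> \<open>The value of \<open>ln\<close> at 0 is a convention, so preimage and ball
        are compared only off the null set {0}.\<close>
      show "AE x in lborel. (x \<in> (\<lambda>x::'a. ln (norm x)) -` {..t}) = (x \<in> cball 0 (exp t))"
      proof (rule AE_mp[OF AE_lborel_singleton[of "0::'a"]], rule AE_I2, rule impI)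
        fix x :: 'a assume "x \<noteq> 0"
        then show "(x \<in> (\<lambda>x::'a. ln (norm x)) -` {..t}) = (x \<in> cball 0 (exp t))"
          by (simp flip: ln_le_cancel_iff[of "norm x" "exp t"])
      qed
    qed (auto intro!: measurable_sets_borel[of _ borel])
    also have "\<dots> = ennreal (?V * exp (?N * t))"
      by (subst emeasure_cball) (auto simp: exp_of_nat_mult)
    finally show ?thesis .
  qed
  then show "emeasure (distr lborel borel (\<lambda>x::'a. ln (norm x))) {..real n} \<noteq> \<infinity>" for n
    by simp
  fix X :: "real set" assume "X \<in> range atMost"
  then obtain t where X: "X = {..t}" by auto
  have "emeasure (density lborel (\<lambda>t. ennreal (radial_const TYPE('a) * exp (?N * t)))) {..t}
      = (\<integral>\<^sup>+s. ennreal (radial_const TYPE('a)) * (ennreal (exp (?N * s)) * indicator {..t} s) \<partial>lborel)"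
    by (subst emeasure_density)
       (auto intro!: nn_integral_cong simp: ennreal_mult mult.assoc less_imp_le[OF radial_const_pos])
  also have "\<dots> = ennreal (?V * exp (?N * t))"
    by (subst nn_integral_cmult, simp, subst nn_integral_exp_Iic[OF N])
       (auto simp: radial_const_def simp flip: ennreal_mult)
  finally show "emeasure (distr lborel borel (\<lambda>x::'a. ln (norm x))) X
      = emeasure (density lborel (\<lambda>t. ennreal (radial_const TYPE('a) * exp (?N * t)))) X"
    by (simp add: X E)
next
  show "Int_stable (range (atMost :: real \<Rightarrow> real set))"
    by (auto simp: Int_stable_def)
  show "\<Union> (range (\<lambda>n. {..real n})) = UNIV"
    using real_arch_simple by (auto simp: set_eq_iff)
qed (auto simp: borel_eq_atMost)

lemma nn_integral_ln_norm:
  fixes F :: "real \<Rightarrow> ennreal"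
  assumes [measurable]: "F \<in> borel_measurable borel"
  shows "(\<integral>\<^sup>+(x::'a::euclidean_space). F (ln (norm x)) \<partial>lborel)
       = ennreal (radial_const TYPE('a)) * (\<integral>\<^sup>+t. ennreal (exp (real DIM('a) * t)) * F t \<partial>lborel)"
proof -
  have "(\<integral>\<^sup>+(x::'a). F (ln (norm x)) \<partial>lborel)
      = (\<integral>\<^sup>+t. F t \<partial>distr lborel borel (\<lambda>x::'a. ln (norm x)))"
    by (simp add: nn_integral_distr)
  also have "\<dots> = (\<integral>\<^sup>+t. ennreal (radial_const TYPE('a)) * (ennreal (exp (real DIM('a) * t)) * F t) \<partial>lborel)"
    unfolding distr_ln_norm
    by (subst nn_integral_density)
       (auto intro!: nn_integral_cong simp: ennreal_mult mult.assoc less_imp_le[OF radial_const_pos])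
  finally show ?thesis
    by (simp add: nn_integral_cmult)
qed

section \<open>Integration by parts away from the origin\<close>

text \<open>The integral of a difference quotient vanishes by translation invariance; dominated
  convergence passes to the derivative, so that no Fubini argument is needed.\<close>
lemma integral_directional_derivative_eq_0:
  fixes w :: "'a::euclidean_space \<Rightarrow> real"
  assumes K: "compact K" "\<And>x. x \<notin> K \<Longrightarrow> w x = 0"
    and D: "\<And>x. (w has_derivative W x) (at x)"
    and M: "\<And>x. \<bar>W x i\<bar> \<le> M"
  shows "(\<integral>x. W x i \<partial>lborel) = 0"
proof -
  define h :: "nat \<Rightarrow> real" where "h n = 1 / real (Suc n)" for n
  have h: "0 < h n" "h n \<le> 1" for n by (auto simp: h_def)
  have lim_h: "h \<longlonglongrightarrow> 0" unfolding h_def by (rule LIMSEQ_Suc[OF lim_1_over_n])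
  define s where "s n x = (w (x + h n *\<^sub>R i) - w x) / h n" for n x
  have cont: "continuous_on UNIV w"
    using D has_derivative_continuous by (intro continuous_at_imp_continuous_on) blast
  then have [measurable]: "w \<in> borel_measurable borel"
    by (rule borel_measurable_continuous_onI)
  have line: "((\<lambda>t. w (x + t *\<^sub>R i)) has_real_derivative W (x + t *\<^sub>R i) i) (at t)" for x t
  proof -
    have L: "linear (W (x + t *\<^sub>R i))" using D has_derivative_linear by blast
    have "((\<lambda>t. w (x + t *\<^sub>R i)) has_derivative (\<lambda>d. W (x + t *\<^sub>R i) (d *\<^sub>R i))) (at t)"
      by (rule has_derivative_compose[where g = w, OF _ D]) (auto intro!: derivative_eq_intros)
    then show ?thesis
      unfolding has_field_derivative_def
      by (rule has_derivative_eq_rhs) (auto simp: linear_scale[OF L])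
  qed
  have s_le: "\<bar>s n x\<bar> \<le> M" for n x
  proof -
    have "norm (w (x + h n *\<^sub>R i) - w (x + 0 *\<^sub>R i)) \<le> M * norm (h n - 0)"
      by (rule field_differentiable_bound[where S = UNIV and f = "\<lambda>t. w (x + t *\<^sub>R i)"])
         (auto intro!: line M)
    then show ?thesis using h[of n] by (simp add: s_def field_simps)
  qed
  have int_w: "integrable lborel w"
  proof -
    have "integrable lborel (\<lambda>x. indicator K x *\<^sub>R w x)"
      using K(1) cont continuous_on_subset by (intro borel_integrable_compact) auto
    also have "(\<lambda>x. indicator K x *\<^sub>R w x) = w"
      using K(2) by (auto simp: indicator_def fun_eq_iff)
    finally show ?thesis .
  qed
  have tr: "integrable lborel (\<lambda>x. w (x + c))" "(\<integral>x. w (x + c) \<partial>lborel) = (\<integral>x. w x \<partial>lborel)" for c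
  proof -
    have "integrable (distr lborel borel ((+) c)) w" using int_w by (simp add: lborel_distr_plus)
    then show "integrable lborel (\<lambda>x. w (x + c))" 
      by (subst (asm) integrable_distr_eq) (auto simp: add.commute)
    have "(\<integral>x. w x \<partial>lborel) = (\<integral>x. w x \<partial>distr lborel borel ((+) c))" by (simp add: lborel_distr_plus)
    then show "(\<integral>x. w (x + c) \<partial>lborel) = (\<integral>x. w x \<partial>lborel)"
      by (subst (asm) integral_distr) (auto simp: add.commute)
  qed
  have s0: "(\<integral>x. s n x \<partial>lborel) = 0" for n
    unfolding s_def using tr[of "h n *\<^sub>R i"] int_w by (simp add: Bochner_Integration.integral_diff)
  obtain R where R: "K \<subseteq> cball 0 R"
    using compact_imp_bounded[OF K(1)] unfolding bounded_iff subset_iff by auto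
  \<comment> \<open>Since h n \<le> 1, a point outside this ball stays outside K after the shift by
    h n times i. One ball thus contains the supports of all difference quotients, which makes the
    dominating function integrable.\<close>
  define K' where "K' = cball (0::'a) (R + norm i)"
  have s_out: "s n x = 0" if "x \<notin> K'" for n x
  proof -
    have "norm x > R + norm i" using that by (simp add: K'_def)
    moreover have "norm (x + h n *\<^sub>R i) \<ge> norm x - norm (h n *\<^sub>R i)" by (rule norm_diff_ineq)
    moreover have "norm (h n *\<^sub>R i) \<le> norm i" using h[of n] by (simp add: mult_left_le_one_le)
    moreover have "norm i \<ge> 0" by simp
    ultimately have "norm x > R" "norm (x + h n *\<^sub>R i) > R" by linarith+
    then have "x \<notin> K" "x + h n *\<^sub>R i \<notin> K" using R by auto
    then show ?thesis using K(2) by (simp add: s_def)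
  qed
  have lim_s: "(\<lambda>n. s n x) \<longlonglongrightarrow> W x i" for x
  proof -
    have "((\<lambda>d. (w (x + d *\<^sub>R i) - w x) / d) \<longlongrightarrow> W x i) (at 0)"
      using line[of x 0] by (simp add: DERIV_def)
    moreover have "filterlim h (at 0) sequentially"
      using lim_h h(1) by (auto simp: filterlim_at intro!: always_eventually) (metis less_irrefl)
    ultimately show ?thesis unfolding s_def by (rule filterlim_compose)
  qed
  have [measurable]: "s n \<in> borel_measurable borel" for n
    unfolding s_def by measurable
  have "(\<lambda>n. \<integral>x. s n x \<partial>lborel) \<longlonglongrightarrow> (\<integral>x. W x i \<partial>lborel)"
  proof (rule integral_dominated_convergence[where w = "\<lambda>x. indicator K' x *\<^sub>R M"])
    \<comment> \<open>The derivative is not assumed continuous; it is measurable as a pointwise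
      limit of difference quotients.\<close>
    show "(\<lambda>x. W x i) \<in> borel_measurable lborel"
      by (rule borel_measurable_LIMSEQ_metric[where f = s]) (auto simp: lim_s)
    show "integrable lborel (\<lambda>x. indicator K' x *\<^sub>R M)"
      by (rule borel_integrable_compact) (auto simp: K'_def)
    show "AE x in lborel. norm (s n x) \<le> indicator K' x *\<^sub>R M" for n
      using s_le s_out by (auto simp: indicator_def)
  qed (auto simp: lim_s)
  then show ?thesis using s0 by (simp add: LIMSEQ_const_iff)
qed

text \<open>Bridge between \<open>lborel\<close>, where the translation argument runs, and its
  completion \<open>lebesgue\<close>, over which the weak derivatives are defined.\<close>

lemma integrable_lebesgue_compact_support:
  fixes f :: "'a::euclidean_space \<Rightarrow> 'b::{banach, second_countable_topology}"
  assumes "compact K" "continuous_on K f" "\<And>x. x \<notin> K \<Longrightarrow> f x = 0"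
  shows "integrable lborel f" "integrable lebesgue f" "(\<integral>x. f x \<partial>lebesgue) = (\<integral>x. f x \<partial>lborel)"
proof -
  have "(\<lambda>x. indicator K x *\<^sub>R f x) = f"
    using assms(3) by (auto simp: indicator_def fun_eq_iff)
  with borel_integrable_compact[OF assms(1,2)] show *: "integrable lborel f" by simp
  then have [measurable]: "f \<in> borel_measurable lborel" by (rule borel_measurable_integrable)
  show "integrable lebesgue f" "(\<integral>x. f x \<partial>lebesgue) = (\<integral>x. f x \<partial>lborel)"
    using * by (simp_all add: integrable_completion integral_completion)
qed

lemma loc_int_star_continuous:
  fixes f :: "'a::euclidean_space \<Rightarrow> 'b::{banach, second_countable_topology}"
  assumes "continuous_on (- {0}) f"
  shows "loc_int_star f"
  unfolding loc_int_star_def set_integrable_def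
proof (intro allI impI, elim conjE)
  fix K :: "'a set" assume "compact K" "0 \<notin> K"
  moreover from this have "continuous_on K f"
    using assms by (rule_tac continuous_on_subset) auto
  then have "continuous_on K (\<lambda>x. indicat_real K x *\<^sub>R f x)"
    by (rule continuous_on_eq) auto
  ultimately show "integrable lebesgue (\<lambda>x. indicat_real K x *\<^sub>R f x)"
    by (intro integrable_lebesgue_compact_support(2)) auto
qed

text \<open>The product of u and \<psi> vanishes off K, hence is differentiable on the whole space,
  and the integral of its directional derivative is 0. \<psi> is more general than a test function
  because the radial derivative is tested against \<phi>(y) (y . i)/|y|.\<close>

lemma integration_by_parts_star:
  fixes u \<psi> :: "'a::euclidean_space \<Rightarrow> real"
  assumes K: "compact K" "0 \<notin> K" "\<And>x. x \<notin> K \<Longrightarrow> \<psi> x = 0"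
    and D: "\<And>x. x \<noteq> 0 \<Longrightarrow> (\<psi> has_derivative D x) (at x)" "continuous_on (- {0}) (\<lambda>x. D x i)"
    and E: "\<And>x. x \<noteq> 0 \<Longrightarrow> (u has_derivative E x) (at x)" "continuous_on (- {0}) (\<lambda>x. E x i)"
  shows "integrable lebesgue (\<lambda>x. u x * frechet_derivative \<psi> (at x) i)" (is ?g1)
    and "integrable lebesgue (\<lambda>x. \<psi> x * E x i)" (is ?g2)
    and "(LINT x|lebesgue. u x * frechet_derivative \<psi> (at x) i) = - (LINT x|lebesgue. \<psi> x * E x i)"
proof -
  have K0: "K \<subseteq> - {0}" using K(2) by auto
  \<comment> \<open>A function vanishing on the open complement of K is locally zero there. This
    covers the origin, about which \<open>D\<close> and \<open>E\<close> say nothing.\<close>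
  have off: "(f has_derivative (\<lambda>_. 0)) (at x)" if "\<And>x. x \<notin> K \<Longrightarrow> f x = 0" "x \<notin> K"
    for f :: "'a \<Rightarrow> real" and x
    by (rule has_derivative_transform_within_open[where f = "\<lambda>_. 0" and s = "- K"])
       (use that compact_imp_closed[OF K(1)] in auto)
  have fd: "frechet_derivative \<psi> (at x) = (if x \<in> K then D x else (\<lambda>_. 0))" for x
  proof (cases "x \<in> K")
    case True
    then have "x \<noteq> 0" using K(2) by auto
    then show ?thesis using frechet_derivative_at[OF D(1)] True by simp
  next
    case False
    then show ?thesis using frechet_derivative_at[OF off[of \<psi> x]] K(3) by simp
  qed
  have cu: "continuous_on K u"
    using E(1) K0 has_derivative_continuous by (intro continuous_at_imp_continuous_on) blast
  have c\<psi>: "continuous_on K \<psi>"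
    using D(1) K0 has_derivative_continuous by (intro continuous_at_imp_continuous_on) blast
  have cD: "continuous_on K (\<lambda>x. D x i)" and cE: "continuous_on K (\<lambda>x. E x i)"
    using D(2) E(2) K0 continuous_on_subset by blast+
  define P where "P x = u x * frechet_derivative \<psi> (at x) i" for x
  define Q where "Q x = \<psi> x * E x i" for x
  have P: "continuous_on K P" "\<And>x. x \<notin> K \<Longrightarrow> P x = 0"
    unfolding P_def fd
    using continuous_on_mult[OF cu cD] by (auto cong: continuous_on_cong)
  have Q: "continuous_on K Q" "\<And>x. x \<notin> K \<Longrightarrow> Q x = 0"
    unfolding Q_def using continuous_on_mult[OF c\<psi> cE] K by auto
  note intP = integrable_lebesgue_compact_support[OF K(1) P]
  note intQ = integrable_lebesgue_compact_support[OF K(1) Q]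
  show ?g1 using intP(2) by (simp add: P_def)
  show ?g2 using intQ(2) by (simp add: Q_def)
  define W where "W x = (if x \<in> K then (\<lambda>d. u x * D x d + E x d * \<psi> x) else (\<lambda>_. 0))" for x
  have W: "((\<lambda>x. u x * \<psi> x) has_derivative W x) (at x)" for x
  proof (cases "x \<in> K")
    case True
    then show ?thesis
      using has_derivative_mult[OF E(1) D(1), of x] K0 by (auto simp: W_def)
  qed (use off[of "\<lambda>x. u x * \<psi> x" x] K in \<open>auto simp: W_def\<close>)
  have Wi: "W x i = P x + Q x" for x
    using P(2) Q(2) by (auto simp: W_def P_def Q_def fd)
  have "bounded ((\<lambda>x. P x + Q x) ` K)"
    by (intro compact_imp_bounded compact_continuous_image continuous_on_add P Q K)
  then obtain M where M: "\<And>x. x \<in> K \<Longrightarrow> \<bar>P x + Q x\<bar> \<le> M"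
    by (auto simp: bounded_iff)
  have M': "\<bar>W x i\<bar> \<le> max M 0" for x
    using M[of x] P(2)[of x] Q(2)[of x] by (cases "x \<in> K") (auto simp: Wi)
  have "(\<integral>x. W x i \<partial>lborel) = 0"
    by (rule integral_directional_derivative_eq_0[OF K(1) _ W M']) (use K in auto)
  then have "(\<integral>x. P x \<partial>lborel) + (\<integral>x. Q x \<partial>lborel) = 0"
    unfolding Wi using intP(1) intQ(1) by (simp add: Bochner_Integration.integral_add)
  then show "(LINT x|lebesgue. u x * frechet_derivative \<psi> (at x) i) = - (LINT x|lebesgue. \<psi> x * E x i)"
    using intP(3) intQ(3) by (simp add: P_def Q_def)
qed

lemma test_fun_support:
  assumes "test_fun \<phi>"
  obtains K where "compact K" "0 \<notin> K" "\<And>x. x \<notin> K \<Longrightarrow> \<phi> x = 0"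
proof (rule that[of "closure {x. \<phi> x \<noteq> 0}"])
  show "\<phi> x = 0" if "x \<notin> closure {x. \<phi> x \<noteq> 0}" for x
    using that subsetD[OF closure_subset, of x "{x. \<phi> x \<noteq> 0}"] by auto
qed (use assms in \<open>auto simp: test_fun_def\<close>)

text \<open>A partial derivative belongs again to the family witnessing smoothness, so it is itself
  differentiable and therefore continuous.\<close>

lemma test_fun_derivative:
  assumes "test_fun \<phi>"
  shows "(\<phi> has_derivative frechet_derivative \<phi> (at x)) (at x)"
    and "i \<in> Basis \<Longrightarrow> continuous_on S (\<lambda>x. frechet_derivative \<phi> (at x) i)"
proof -
  obtain F where "\<phi> \<in> F" and F: "\<And>h x. h \<in> F \<Longrightarrow> h differentiable (at x)"
    "\<And>h i. h \<in> F \<Longrightarrow> i \<in> Basis \<Longrightarrow> (\<lambda>x. frechet_derivative h (at x) i) \<in> F"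
    using assms unfolding test_fun_def smooth_fun_def by blast
  then show "(\<phi> has_derivative frechet_derivative \<phi> (at x)) (at x)"
    using frechet_derivative_works by blast
  show "continuous_on S (\<lambda>x. frechet_derivative \<phi> (at x) i)" if "i \<in> Basis"
    using F(1)[OF F(2)[OF \<open>\<phi> \<in> F\<close> that]] differentiable_imp_continuous_within
    by (intro continuous_at_imp_continuous_on) blast
qed

text \<open>Integration by parts in each coordinate. The function may be arbitrarily singular at the
  origin, because test functions vanish near it.\<close>

lemma weak_grad_C1:
  fixes u :: "'a::euclidean_space \<Rightarrow> real"
  assumes u: "\<And>x. x \<noteq> 0 \<Longrightarrow> (u has_derivative (\<lambda>d. g x \<bullet> d)) (at x)"
    and g: "continuous_on (- {0}) g"
  shows "weak_grad u g"
  unfolding weak_grad_def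
proof (intro conjI allI impI)
  show "loc_int_star u"
    using u has_derivative_continuous
    by (intro loc_int_star_continuous continuous_at_imp_continuous_on) blast
  show "loc_int_star g" by (rule loc_int_star_continuous[OF g])
  fix \<phi> :: "'a \<Rightarrow> real" assume \<phi>: "test_fun \<phi>"
  obtain K where K: "compact K" "0 \<notin> K" "\<And>x. x \<notin> K \<Longrightarrow> \<phi> x = 0"
    using test_fun_support[OF \<phi>] by blast
  have ibp: "integrable lebesgue (\<lambda>x. u x * frechet_derivative \<phi> (at x) i)"
    "integrable lebesgue (\<lambda>x. \<phi> x * (g x \<bullet> i))"
    "(LINT x|lebesgue. u x * frechet_derivative \<phi> (at x) i) = - (LINT x|lebesgue. \<phi> x * (g x \<bullet> i))"
    if "i \<in> Basis" for i
    by (rule integration_by_parts_star[where E = "\<lambda>x d. g x \<bullet> d" and i = i, OF K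
          test_fun_derivative(1)[OF \<phi>] test_fun_derivative(2)[OF \<phi> that] u
          continuous_on_inner[OF g continuous_on_const]]; assumption)+
  have eqL: "(\<lambda>x. u x *\<^sub>R grad \<phi> x) = (\<lambda>x. \<Sum>i\<in>Basis. (u x * frechet_derivative \<phi> (at x) i) *\<^sub>R i)"
    by (simp add: grad_def scaleR_sum_right fun_eq_iff)
  have eqR: "(\<lambda>x. \<phi> x *\<^sub>R g x) = (\<lambda>x. \<Sum>i\<in>Basis. (\<phi> x * (g x \<bullet> i)) *\<^sub>R i)"
    by (simp add: euclidean_representation flip: scaleR_scaleR scaleR_sum_right)
  show "(LINT x|lebesgue. u x *\<^sub>R grad \<phi> x) = - (LINT x|lebesgue. \<phi> x *\<^sub>R g x)"
    unfolding eqL eqR using ibp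
    by (simp add: Bochner_Integration.integral_sum sum_negf)
qed

text \<open>In coordinate i the integration by parts is done against \<phi>(x) x_i/|x|; summing over
  i collects the products (x_i/|x|) g_i into the radial component of the gradient.\<close>

lemma weak_radial_C1:
  fixes u :: "'a::euclidean_space \<Rightarrow> real"
  assumes u: "\<And>x. x \<noteq> 0 \<Longrightarrow> (u has_derivative (\<lambda>d. g x \<bullet> d)) (at x)"
    and g: "continuous_on (- {0}) g"
  shows "weak_radial u (\<lambda>x. (g x \<bullet> x) / norm x)"
  unfolding weak_radial_def
proof (intro conjI allI impI)
  show "loc_int_star u"
    using u has_derivative_continuous
    by (intro loc_int_star_continuous continuous_at_imp_continuous_on) blast
  show "loc_int_star (\<lambda>x. (g x \<bullet> x) / norm x)"
    by (rule loc_int_star_continuous) (auto intro!: continuous_intros g)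
  fix \<phi> :: "'a \<Rightarrow> real" assume \<phi>: "test_fun \<phi>"
  obtain K where K: "compact K" "0 \<notin> K" "\<And>x. x \<notin> K \<Longrightarrow> \<phi> x = 0"
    using test_fun_support[OF \<phi>] by blast
  \<comment> \<open>Quotient rule; the last summand comes from the derivative (x . d)/|x| of the
    norm, divided by |x|^2.\<close>
  define D where "D i x d = (\<phi> x * (d \<bullet> i) + frechet_derivative \<phi> (at x) d * (x \<bullet> i)) / norm x
      - \<phi> x * (x \<bullet> i) * (x \<bullet> d) / norm x ^ 3" for i x d :: 'a
  have D: "((\<lambda>y. \<phi> y * (y \<bullet> i) / norm y) has_derivative D i x) (at x)" if "x \<noteq> 0" for i x
    unfolding D_def
    by (rule has_derivative_eq_rhs[OF has_derivative_divide[OF has_derivative_mult[OF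
          test_fun_derivative(1)[OF \<phi>] has_derivative_inner_left[OF has_derivative_ident]]
          has_derivative_norm[OF that]]])
       (use that in \<open>simp_all add: fun_eq_iff sgn_div_norm inner_commute divide_simps power3_eq_cube algebra_simps\<close>)
  have contD: "continuous_on (- {0}) (\<lambda>x. D i x i)" if "i \<in> Basis" for i
  proof -
    have "continuous_on (- {0}) \<phi>"
      using test_fun_derivative(1)[OF \<phi>] has_derivative_continuous
      by (intro continuous_at_imp_continuous_on) blast
    then show ?thesis
      unfolding D_def by (auto intro!: continuous_intros test_fun_derivative(2)[OF \<phi>] that)
  qed
  have ibp: "integrable lebesgue (\<lambda>x. u x * frechet_derivative (\<lambda>y. \<phi> y * (y \<bullet> i) / norm y) (at x) i)"
    "integrable lebesgue (\<lambda>x. \<phi> x * (x \<bullet> i) / norm x * (g x \<bullet> i))"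
    "(LINT x|lebesgue. u x * frechet_derivative (\<lambda>y. \<phi> y * (y \<bullet> i) / norm y) (at x) i)
      = - (LINT x|lebesgue. \<phi> x * (x \<bullet> i) / norm x * (g x \<bullet> i))"
    if "i \<in> Basis" for i
    by (rule integration_by_parts_star[where E = "\<lambda>x d. g x \<bullet> d" and D = "D i" and i = i, OF K(1,2) _
          D contD[OF that] u continuous_on_inner[OF g continuous_on_const]]; simp add: K(3))+
  have eqR: "(\<lambda>x. (g x \<bullet> x) / norm x * \<phi> x) = (\<lambda>x. \<Sum>i\<in>Basis. \<phi> x * (x \<bullet> i) / norm x * (g x \<bullet> i))"
    by (subst euclidean_inner) (simp add: fun_eq_iff sum_distrib_left sum_distrib_right sum_divide_distrib mult_ac)
  show "(LINT x|lebesgue. u x * (\<Sum>i\<in>Basis. frechet_derivative (\<lambda>y. \<phi> y * (y \<bullet> i) / norm y) (at x) i))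
      = - (LINT x|lebesgue. (g x \<bullet> x) / norm x * \<phi> x)"
    unfolding eqR sum_distrib_left using ibp
    by (simp add: Bochner_Integration.integral_sum sum_negf)
qed

section \<open>From radial functions on R^N to profiles on the line\<close>

lemma log_radial_derivative:
  fixes v v' :: "real \<Rightarrow> real"
  assumes "\<And>t. (v has_real_derivative v' t) (at t)" and "x \<noteq> 0"
  shows "((\<lambda>x::'a::euclidean_space. v (ln (norm x))) has_derivative
     (\<lambda>d. ((v' (ln (norm x)) / (norm x)\<^sup>2) *\<^sub>R x) \<bullet> d)) (at x)"
proof -
  have "((\<lambda>x. ln (norm x)) has_derivative (\<lambda>d. (x \<bullet> d) / (norm x)\<^sup>2)) (at x)"
    by (rule has_derivative_eq_rhs[OF has_derivative_compose[OF has_derivative_norm[OF assms(2)]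
          DERIV_ln[unfolded has_field_derivative_def]]])
       (use assms(2) in \<open>simp_all add: fun_eq_iff sgn_div_norm inner_commute power2_eq_square field_simps\<close>)
  from has_derivative_compose[OF this assms(1)[unfolded has_field_derivative_def]]
  show ?thesis by (rule has_derivative_eq_rhs) (auto simp: mult_ac)
qed

definition logint :: "real \<Rightarrow> real \<Rightarrow> (real \<Rightarrow> real) \<Rightarrow> ennreal" where
  "logint k s f = (\<integral>\<^sup>+t. ennreal (exp (k * t) * \<bar>f t\<bar> powr s) \<partial>lborel)"

text \<open>The number e is the power of 1/|x| split off from the profile: 0 for a function, 1 for
  its gradient or radial derivative.\<close>

lemma wint_log_radial:
  fixes f :: "'a::euclidean_space \<Rightarrow> 'b::real_normed_vector"
  assumes f: "\<And>x. x \<noteq> 0 \<Longrightarrow> norm (f x) = exp (- e * ln (norm x)) * \<bar>v (ln (norm x))\<bar>"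
    and [measurable]: "v \<in> borel_measurable borel"
  shows "wint d s f = ennreal (radial_const TYPE('a)) * logint (d - e * s + real DIM('a)) s v"
proof -
  have "wint d s f = (\<integral>\<^sup>+x. ennreal (norm x powr d * norm (f x) powr s) \<partial>lborel)"
    by (simp add: wint_def nn_integral_completion)
  also have "\<dots> = (\<integral>\<^sup>+(x::'a). ennreal (exp ((d - e * s) * ln (norm x)) * \<bar>v (ln (norm x))\<bar> powr s) \<partial>lborel)"
  proof (rule nn_integral_cong_AE, rule AE_mp[OF AE_lborel_singleton[of "0::'a"]], rule AE_I2, rule impI)
    fix x :: 'a assume "x \<noteq> 0"
    then show "ennreal (norm x powr d * norm (f x) powr s)
        = ennreal (exp ((d - e * s) * ln (norm x)) * \<bar>v (ln (norm x))\<bar> powr s)"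
      by (simp add: f powr_mult powr_def[of "norm x"] powr_def[of "exp _"] algebra_simps flip: exp_add)
  qed
  also have "\<dots> = ennreal (radial_const TYPE('a)) * logint (d - e * s + real DIM('a)) s v"
    unfolding logint_def
    by (subst nn_integral_ln_norm[where F = "\<lambda>t. ennreal (exp ((d - e * s) * t) * \<bar>v t\<bar> powr s)"])
       (auto intro!: arg_cong2[where f = "(*)"] nn_integral_cong
         simp: distrib_left distrib_right exp_add mult_ac simp flip: ennreal_mult)
  finally show ?thesis .
qed

definition C1_deriv :: "(real \<Rightarrow> real) \<Rightarrow> (real \<Rightarrow> real) \<Rightarrow> bool" where
  "C1_deriv v v' \<longleftrightarrow> (\<forall>t. (v has_real_derivative v' t) (at t)) \<and> continuous_on UNIV v'"

text \<open>The gradient of ln |x| has length 1/|x|, which lowers the weight d to d - s. As it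
  points along x, the full gradient \<open>g\<close> and the radial derivative \<open>h\<close> have
  equal norms.\<close>

lemma log_radial_witness:
  fixes v v' :: "real \<Rightarrow> real"
  assumes v: "C1_deriv v v'"
  defines "u \<equiv> \<lambda>x::'a::euclidean_space. v (ln (norm x))"
    and "g \<equiv> \<lambda>x::'a. (v' (ln (norm x)) / (norm x)\<^sup>2) *\<^sub>R x"
    and "h \<equiv> \<lambda>x::'a. v' (ln (norm x)) / norm x"
    and "\<omega> \<equiv> ennreal (radial_const TYPE('a))"
    and "N \<equiv> real DIM('a)"
  shows "loc_int_star u" "weak_grad u g" "weak_radial u h"
    and "u \<in> borel_measurable lebesgue" "g \<in> borel_measurable lebesgue" "h \<in> borel_measurable lebesgue"
    and "wint d s u = \<omega> * logint (d + N) s v"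
    and "wint d s g = \<omega> * logint (d - s + N) s v'"
    and "wint d s h = \<omega> * logint (d - s + N) s v'"
proof -
  have dv: "\<And>t. (v has_real_derivative v' t) (at t)" and cv': "continuous_on UNIV v'"
    using v by (auto simp: C1_deriv_def)
  have cv: "continuous_on UNIV v"
    using dv DERIV_isCont by (blast intro: continuous_at_imp_continuous_on)
  have [measurable]: "v \<in> borel_measurable borel" "v' \<in> borel_measurable borel"
    using cv cv' by (auto intro: borel_measurable_continuous_onI)
  have du: "(u has_derivative (\<lambda>d. g x \<bullet> d)) (at x)" if "x \<noteq> 0" for x
    unfolding u_def g_def using log_radial_derivative[OF dv that] .
  have "continuous_on (- {0}) (\<lambda>x::'a. v' (ln (norm x)))"
    by (rule continuous_on_compose2[OF cv']) (auto intro!: continuous_on_ln continuous_on_norm)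
  then have cg: "continuous_on (- {0}) g"
    unfolding g_def
    by (intro continuous_on_scaleR continuous_on_divide continuous_on_power continuous_on_norm) auto
  show "weak_grad u g" by (rule weak_grad_C1[OF du cg])
  then show "loc_int_star u" by (simp add: weak_grad_def)
  \<comment> \<open>At x = 0 both sides are 0 because division by zero gives 0.\<close>
  have "(g x \<bullet> x) / norm x = h x" for x
    by (cases "x = 0") (simp_all add: g_def h_def flip: power2_norm_eq_inner)
  then show "weak_radial u h"
    using weak_radial_C1[OF du cg] by simp
  show "u \<in> borel_measurable lebesgue" "g \<in> borel_measurable lebesgue" "h \<in> borel_measurable lebesgue"
    unfolding u_def g_def h_def by (auto intro!: measurable_completion)
  show "wint d s u = \<omega> * logint (d + N) s v"
    using wint_log_radial[of u 0 v] by (simp add: u_def \<omega>_def N_def)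
  have "norm (g x) = exp (- 1 * ln (norm x)) * \<bar>v' (ln (norm x))\<bar>"
    "norm (h x) = exp (- 1 * ln (norm x)) * \<bar>v' (ln (norm x))\<bar>" if "x \<noteq> 0" for x
    using that by (simp_all add: g_def h_def exp_minus field_simps power2_eq_square)
  then show "wint d s g = \<omega> * logint (d - s + N) s v'" "wint d s h = \<omega> * logint (d - s + N) s v'"
    using wint_log_radial[of g 1 v' d s] wint_log_radial[of h 1 v' d s] by (simp_all add: \<omega>_def N_def)
qed

lemma not_subset_log_radial:
  fixes a b c p q r :: real and v v' :: "real \<Rightarrow> real"
  defines "N \<equiv> real DIM('a::euclidean_space)"
  assumes v: "C1_deriv v v'"
    and "logint (a + N) q v < \<infinity>" "logint (b - p + N) p v' < \<infinity>" "logint (c + N) r v = \<infinity>"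
  shows "\<not> (Wsp a b q p :: ('a \<Rightarrow> real) set) \<subseteq> Lset c r"
    and "\<not> (Wtsp a b q p :: ('a \<Rightarrow> real) set) \<subseteq> Lset c r"
proof -
  let ?u = "\<lambda>x::'a. v (ln (norm x))"
  note w = log_radial_witness[OF v, where 'a = 'a]
  have "inL a q ?u" "inL b p (\<lambda>x::'a. (v' (ln (norm x)) / (norm x)\<^sup>2) *\<^sub>R x)"
    "inL b p (\<lambda>x::'a. v' (ln (norm x)) / norm x)"
    using w(4-9) assms(3,4) by (auto simp: inL_def N_def ennreal_mult_less_top)
  then have "?u \<in> Wsp a b q p" "?u \<in> Wtsp a b q p"
    using w(1-3) by (auto simp: Wsp_def Wtsp_def)
  moreover have "?u \<notin> Lset c r"
    using w(7) assms(5) radial_const_pos[where 'a = 'a]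
    by (auto simp: Lset_def inL_def N_def ennreal_mult_top)
  ultimately show "\<not> (Wsp a b q p :: ('a \<Rightarrow> real) set) \<subseteq> Lset c r"
    and "\<not> (Wtsp a b q p :: ('a \<Rightarrow> real) set) \<subseteq> Lset c r"
    by blast+
qed

text \<open>Either embedding yields the same inequality on the line, so the contradiction has to be
  derived only once.\<close>

lemma emb_log_radial:
  fixes a b c p q r :: real
  defines "N \<equiv> real DIM('a::euclidean_space)"
  assumes emb: "emb_W TYPE('a) a b q p c r \<or> emb_Wt TYPE('a) a b q p c r"
  obtains C where "C \<ge> 0"
    "\<And>v v'. C1_deriv v v' \<Longrightarrow> logint (a + N) q v < \<infinity> \<Longrightarrow> logint (b - p + N) p v' < \<infinity> \<Longrightarrow>
       logint (c + N) r v < \<infinity> \<and>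
       enn2real (logint (c + N) r v) powr (1 / r)
         \<le> C * (enn2real (logint (a + N) q v) powr (1 / q) + enn2real (logint (b - p + N) p v') powr (1 / p))"
proof -
  define \<omega> where "\<omega> = radial_const TYPE('a)"
  have \<omega>: "\<omega> > 0" unfolding \<omega>_def by (rule radial_const_pos)
  obtain C0 where C0: "\<And>v v'. C1_deriv v v' \<Longrightarrow> logint (a + N) q v < \<infinity> \<Longrightarrow> logint (b - p + N) p v' < \<infinity> \<Longrightarrow>
       logint (c + N) r v < \<infinity> \<and>
       enn2real (ennreal \<omega> * logint (c + N) r v) powr (1 / r)
         \<le> C0 * (enn2real (ennreal \<omega> * logint (a + N) q v) powr (1 / q)
           + enn2real (ennreal \<omega> * logint (b - p + N) p v') powr (1 / p))"
    using emb
  proof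
    assume "emb_W TYPE('a) a b q p c r"
    then obtain C0 where C0: "\<And>(u::'a \<Rightarrow> real) g. loc_int_star u \<Longrightarrow> inL a q u \<Longrightarrow> weak_grad u g \<Longrightarrow> inL b p g \<Longrightarrow>
      inL c r u \<and> wnorm c r u \<le> C0 * (wnorm a q u + wnorm b p g)"
      unfolding emb_W_def by blast
    show thesis
    proof (rule that[of C0], goal_cases)
      case (1 v v')
      note w = log_radial_witness[OF 1(1), where 'a = 'a]
      have "inL a q (\<lambda>x::'a. v (ln (norm x)))" "inL b p (\<lambda>x::'a. (v' (ln (norm x)) / (norm x)\<^sup>2) *\<^sub>R x)"
        using w(4-9) 1 by (auto simp: inL_def N_def ennreal_mult_less_top)
      from C0[OF w(1) this(1) w(2) this(2)] show ?case
        using w(7,8) \<omega> by (auto simp: inL_def wnorm_def N_def \<omega>_def ennreal_mult_less_top)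
    qed
  next
    assume "emb_Wt TYPE('a) a b q p c r"
    then obtain C0 where C0: "\<And>(u::'a \<Rightarrow> real) h. loc_int_star u \<Longrightarrow> inL a q u \<Longrightarrow> weak_radial u h \<Longrightarrow> inL b p h \<Longrightarrow>
      inL c r u \<and> wnorm c r u \<le> C0 * (wnorm a q u + wnorm b p h)"
      unfolding emb_Wt_def by blast
    show thesis
    proof (rule that[of C0], goal_cases)
      case (1 v v')
      note w = log_radial_witness[OF 1(1), where 'a = 'a]
      have "inL a q (\<lambda>x::'a. v (ln (norm x)))" "inL b p (\<lambda>x::'a. v' (ln (norm x)) / norm x)"
        using w(4-9) 1 by (auto simp: inL_def N_def ennreal_mult_less_top)
      from C0[OF w(1) this(1) w(3) this(2)] show ?case
        using w(7,9) \<omega> by (auto simp: inL_def wnorm_def N_def \<omega>_def ennreal_mult_less_top)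
    qed
  qed
  \<comment> \<open>The sphere factor \<omega> enters the three norms with the powers 1/q, 1/p and
    1/r: the larger of the first two bounds the right side, the third is divided out on the left.
    \<open>max C0 0\<close> gives a sign to a constant that came without one.\<close>
  define C where "C = max C0 0 * max (\<omega> powr (1 / q)) (\<omega> powr (1 / p)) / \<omega> powr (1 / r)"
  show thesis
  proof (rule that[of C], goal_cases)
    case 1
    show "C \<ge> 0" unfolding C_def by (auto simp: le_max_iff_disj)
  next
    case (2 v v')
    define X Y Z where "X = enn2real (logint (a + N) q v) powr (1 / q)"
      and "Y = enn2real (logint (b - p + N) p v') powr (1 / p)"
      and "Z = enn2real (logint (c + N) r v) powr (1 / r)"
    have pos: "X \<ge> 0" "Y \<ge> 0" by (simp_all add: X_def Y_def)
    note C = C0[OF 2]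
    have "\<omega> powr (1 / r) * Z \<le> C0 * (\<omega> powr (1 / q) * X + \<omega> powr (1 / p) * Y)"
      using C \<omega> by (simp add: X_def Y_def Z_def enn2real_mult powr_mult)
    also have "\<dots> \<le> max C0 0 * (\<omega> powr (1 / q) * X + \<omega> powr (1 / p) * Y)"
      using pos by (intro mult_right_mono add_nonneg_nonneg mult_nonneg_nonneg) auto
    also have "\<dots> \<le> max C0 0 * (max (\<omega> powr (1 / q)) (\<omega> powr (1 / p)) * X
        + max (\<omega> powr (1 / q)) (\<omega> powr (1 / p)) * Y)"
      using pos by (intro mult_left_mono add_mono mult_right_mono) auto
    finally have "Z \<le> C * (X + Y)"
      using \<omega> by (simp add: C_def field_simps)
    with C show ?case by (simp add: X_def Y_def Z_def)
  qed
qed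

section \<open>Estimates for integrals with exponential weight\<close>

text \<open>Writing t = \<tau> + (t - \<tau>) in e^((k-ms) t) separates the dependence on the
  centre, later sent to plus or minus infinity, from the dependence on the width.\<close>

lemma logint_exp_le:
  assumes "s > 0" "K \<ge> 0" "L > 0"
    and "\<And>t. \<bar>f t\<bar> \<le> K * exp (- m * t)" and "\<And>t. \<bar>t - \<tau>\<bar> > L \<Longrightarrow> f t = 0"
  shows "logint k s f \<le> ennreal (K powr s * (2 * L) * exp ((k - m * s) * \<tau> + \<bar>k - m * s\<bar> * L))"
proof -
  let ?E = "exp ((k - m * s) * \<tau> + \<bar>k - m * s\<bar> * L)"
  have "logint k s f \<le> (\<integral>\<^sup>+t. ennreal (K powr s * ?E) * indicator {\<tau> - L .. \<tau> + L} t \<partial>lborel)"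
    unfolding logint_def
  proof (rule nn_integral_mono)
    fix t :: real
    show "ennreal (exp (k * t) * \<bar>f t\<bar> powr s) \<le> ennreal (K powr s * ?E) * indicator {\<tau> - L .. \<tau> + L} t"
    proof (cases "\<bar>t - \<tau>\<bar> \<le> L")
      case True
      have "\<bar>f t\<bar> powr s \<le> (K * exp (- m * t)) powr s"
        using assms by (intro powr_mono2) auto
      also have "\<dots> = K powr s * exp (- m * s * t)"
        using assms by (simp add: powr_mult powr_def[of "exp _"] mult_ac)
      finally have "exp (k * t) * \<bar>f t\<bar> powr s \<le> exp (k * t) * (K powr s * exp (- m * s * t))"
        by simp
      also have "\<dots> = K powr s * exp ((k - m * s) * \<tau> + (k - m * s) * (t - \<tau>))"
        by (simp add: algebra_simps flip: exp_add)
      also have "(k - m * s) * (t - \<tau>) \<le> \<bar>k - m * s\<bar> * L"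
        using mult_left_mono[OF True, of "\<bar>k - m * s\<bar>"] by (simp flip: abs_mult)
      hence "K powr s * exp ((k - m * s) * \<tau> + (k - m * s) * (t - \<tau>)) \<le> K powr s * ?E"
        by (intro mult_left_mono) auto
      finally show ?thesis using True by (auto simp: indicator_def intro!: ennreal_leI)
    qed (use assms in simp)
  qed
  also have "\<dots> = ennreal (K powr s * (2 * L) * ?E)"
    using assms(3) by (subst nn_integral_cmult_indicator) (simp_all add: mult_ac flip: ennreal_mult)
  finally show ?thesis .
qed

text \<open>At the critical weight k = m s the exponentials cancel, so the bound does not depend on
  the centre \<tau>.\<close>

lemma logint_exp_ge:
  assumes "s > 0" "K \<ge> 0" "L > 0"
    and "\<And>t. \<bar>t - \<tau>\<bar> \<le> L \<Longrightarrow> \<bar>f t\<bar> \<ge> K * exp (- m * t)"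
  shows "logint (m * s) s f \<ge> ennreal (K powr s * (2 * L))"
proof -
  have "ennreal (K powr s * (2 * L)) = (\<integral>\<^sup>+t. ennreal (K powr s) * indicator {\<tau> - L .. \<tau> + L} t \<partial>lborel)"
    using assms(3) by (simp add: nn_integral_cmult mult_ac flip: ennreal_mult)
  also have "\<dots> \<le> logint (m * s) s f"
    unfolding logint_def
  proof (rule nn_integral_mono)
    fix t :: real
    show "ennreal (K powr s) * indicator {\<tau> - L .. \<tau> + L} t \<le> ennreal (exp (m * s * t) * \<bar>f t\<bar> powr s)"
    proof (cases "t \<in> {\<tau> - L .. \<tau> + L}")
      case True
      have "K powr s = exp (m * s * t) * (K powr s * exp (- m * s * t))"
        by (simp add: exp_minus)
      also have "K powr s * exp (- m * s * t) = (K * exp (- m * t)) powr s"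
        using assms by (simp add: powr_mult powr_def[of "exp _"] mult_ac)
      also have "\<dots> \<le> \<bar>f t\<bar> powr s"
        using assms(1,2) assms(4)[of t] True by (intro powr_mono2) auto
      finally show ?thesis using True by (auto intro!: ennreal_leI)
    qed simp
  qed
  finally show ?thesis .
qed

text \<open>The sign \<sigma> selects the right or the left half-line, so that one proof serves
  infinity and the origin of R^N; the sign condition is decay of e^((k-ms) t) along the chosen
  half-line.\<close>

lemma logint_half_line_finite:
  assumes "s > 0" "K \<ge> 0" "\<bar>\<sigma>\<bar> = 1" "\<sigma> * (k - m * s) < 0"
    and "\<And>t. \<bar>f t\<bar> \<le> K * exp (- m * t)" and "\<And>t. \<sigma> * t < 0 \<Longrightarrow> f t = 0"
  shows "logint k s f < \<infinity>"
proof -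
  let ?I = "if \<sigma> = 1 then {0..} else {..0 :: real}"
  have "logint k s f \<le> (\<integral>\<^sup>+t. ennreal (K powr s) * (ennreal (exp ((k - m * s) * t)) * indicator ?I t) \<partial>lborel)"
    unfolding logint_def
  proof (rule nn_integral_mono)
    fix t :: real
    show "ennreal (exp (k * t) * \<bar>f t\<bar> powr s)
        \<le> ennreal (K powr s) * (ennreal (exp ((k - m * s) * t)) * indicator ?I t)"
    proof (cases "\<sigma> * t < 0")
      case False
      have "\<bar>f t\<bar> powr s \<le> (K * exp (- m * t)) powr s"
        using assms by (intro powr_mono2) auto
      also have "\<dots> = K powr s * exp (- m * s * t)"
        using assms by (simp add: powr_mult powr_def[of "exp _"] mult_ac)
      finally have "exp (k * t) * \<bar>f t\<bar> powr s \<le> exp (k * t) * (K powr s * exp (- m * s * t))"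
        by simp
      also have "\<dots> = K powr s * exp ((k - m * s) * t)"
        by (simp add: algebra_simps flip: exp_add)
      finally show ?thesis using False assms(3)
        by (auto simp: indicator_def abs_if split: if_splits intro!: ennreal_leI simp flip: ennreal_mult)
    qed (use assms in simp)
  qed
  also have "\<dots> = ennreal (K powr s) * (\<integral>\<^sup>+t. ennreal (exp ((k - m * s) * t)) * indicator ?I t \<partial>lborel)"
    by (rule nn_integral_cmult) auto
  also have "\<dots> < \<infinity>"
    using nn_integral_exp_Ici[of "- (k - m * s)" 0] nn_integral_exp_Iic[of "k - m * s" 0] assms(3,4)
    by (auto simp: abs_if ennreal_mult_less_top split: if_splits)
  finally show ?thesis .
qed

text \<open>Where \<sigma> t \<ge> 1 the integrand is at least 1, and this set contains arbitrarily
  long intervals.\<close>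

lemma logint_half_line_infinite:
  assumes "s > 0" "\<bar>\<sigma>\<bar> = 1" "\<sigma> * (k - m * s) \<ge> 0"
    and "\<And>t. \<sigma> * t \<ge> 1 \<Longrightarrow> f t = exp (- m * t)"
  shows "logint k s f = \<infinity>"
proof -
  have ge: "ennreal (real n) \<le> logint k s f" for n
  proof -
    \<comment> \<open>The centre is shifted by 1 so that this interval, of length 2n, stays inside
      \<sigma> t \<ge> 1 for either sign.\<close>
    let ?I = "{\<sigma> * (1 + real n) - real n .. \<sigma> * (1 + real n) + real n}"
    have "ennreal (real n) \<le> (\<integral>\<^sup>+t. indicator ?I t \<partial>lborel)"
      by (auto intro!: ennreal_leI)
    also have "\<dots> \<le> logint k s f"
      unfolding logint_def
    proof (rule nn_integral_mono)
      fix t :: real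
      show "indicator ?I t \<le> ennreal (exp (k * t) * \<bar>f t\<bar> powr s)"
      proof (cases "t \<in> ?I")
        case True
        then have t: "\<sigma> * t \<ge> 1" using assms(2) by (auto simp: abs_if split: if_splits)
        have "0 \<le> (\<sigma> * (k - m * s)) * (\<sigma> * t)"
          by (rule mult_nonneg_nonneg[OF assms(3)]) (use t in linarith)
        also have "\<dots> = (\<sigma> * \<sigma>) * ((k - m * s) * t)" by (simp add: mult_ac)
        also have "\<sigma> * \<sigma> = 1" using assms(2) by (metis abs_mult_self_eq mult_1)
        finally have "1 \<le> exp (k * t + - m * s * t)" by (simp add: algebra_simps)
        also have "\<dots> = exp (k * t) * \<bar>f t\<bar> powr s"
        proof -
          have "\<bar>f t\<bar> powr s = exp (- m * s * t)"
            using assms(4)[OF t] by (simp add: powr_def mult_ac)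
          then show ?thesis by (simp only: exp_add)
        qed
        finally show ?thesis using True by (simp flip: ennreal_1)
      qed simp
    qed
    finally show ?thesis .
  qed
  show ?thesis
  proof (rule ccontr)
    assume "logint k s f \<noteq> \<infinity>"
    then obtain x where x: "x \<ge> 0" "logint k s f = ennreal x"
      by (cases "logint k s f") auto
    obtain n where "x < real n"
      using reals_Archimedean2 by blast
    with ge[of n] x show False
      by simp
  qed
qed

section \<open>Step and bump profiles of class C^1\<close>

text \<open>Squaring removes the corner of the positive part: at 0 the difference quotient is
  \<open>max 0 y\<close>, which tends to 0. Both cutoffs are composed of this function.\<close>

lemma DERIV_max_0_square:
  "((\<lambda>t. (max 0 t)\<^sup>2) has_real_derivative 2 * max 0 t) (at t)" for t :: real
proof (cases "t = 0")
  case True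
  have "((\<lambda>y::real. max 0 y) \<longlongrightarrow> max 0 0) (at 0)"
    by (intro tendsto_intros)
  moreover have "((max 0 y)\<^sup>2 - (max 0 0)\<^sup>2) / (y - 0) = max 0 y" for y :: real
    by (simp add: max_def power2_eq_square)
  ultimately show ?thesis using True by (simp add: has_field_derivative_iff)
next
  case False
  then have "((\<lambda>t. if 0 < t then t\<^sup>2 else 0) has_real_derivative 2 * max 0 t) (at t)"
  proof (cases "t > 0")
    case True
    show ?thesis
      by (rule has_field_derivative_transform_within_open[where f = "\<lambda>t. t\<^sup>2" and S = "{0<..}"])
         (use True in \<open>auto intro!: derivative_eq_intros\<close>)
  next
    case False
    show ?thesis
      by (rule has_field_derivative_transform_within_open[where f = "\<lambda>t. 0" and S = "{..<0}"])
         (use False \<open>t \<noteq> 0\<close> in \<open>auto intro!: derivative_eq_intros\<close>)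
  qed
  also have "(\<lambda>t. if 0 < t then t\<^sup>2 else 0) = (\<lambda>t::real. (max 0 t)\<^sup>2)"
    by (auto simp: max_def fun_eq_iff)
  finally show ?thesis .
qed

text \<open>Used with the argument \<sigma> t for the step and (t - \<tau>)/L for the bump.\<close>

lemma C1_deriv_exp_mult_compose:
  assumes "C1_deriv g g'"
  shows "C1_deriv (\<lambda>t. exp (- m * t) * g (\<alpha> * t + \<beta>))
     (\<lambda>t. exp (- m * t) * (\<alpha> * g' (\<alpha> * t + \<beta>) - m * g (\<alpha> * t + \<beta>)))"
proof -
  have g: "\<And>t. (g has_real_derivative g' t) (at t)" and g': "continuous_on UNIV g'"
    using assms by (auto simp: C1_deriv_def)
  have affine: "continuous_on UNIV (\<lambda>t. f (\<alpha> * t + \<beta>))" if "continuous_on UNIV f" for f :: "real \<Rightarrow> real"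
    by (rule continuous_on_compose2[OF that]) (auto intro!: continuous_intros)
  have "continuous_on UNIV g"
    using g DERIV_isCont by (blast intro: continuous_at_imp_continuous_on)
  note affine[OF this] affine[OF g']
  moreover have "((\<lambda>t. g (\<alpha> * t + \<beta>)) has_real_derivative g' (\<alpha> * t + \<beta>) * \<alpha>) (at t)" for t
    by (rule DERIV_chain2[OF g]) (auto intro!: derivative_eq_intros)
  ultimately show ?thesis
    unfolding C1_deriv_def
    by (auto intro!: continuous_intros derivative_eq_intros simp: right_diff_distrib)
qed

text \<open>Equal to 1 - (1 - t^2)^2 on [0,1], to 0 on the left and to 1 on the right; each positive
  part is squared, so the function is C^1.\<close>

definition smooth_step :: "real \<Rightarrow> real" where
  "smooth_step t = 1 - (max 0 (1 - (max 0 t)\<^sup>2))\<^sup>2"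

definition smooth_step' :: "real \<Rightarrow> real" where
  "smooth_step' t = 2 * max 0 (1 - (max 0 t)\<^sup>2) * (2 * max 0 t)"

definition smooth_bump :: "real \<Rightarrow> real" where
  "smooth_bump t = (max 0 (1 - t\<^sup>2))\<^sup>2"

definition smooth_bump' :: "real \<Rightarrow> real" where
  "smooth_bump' t = - (2 * max 0 (1 - t\<^sup>2) * (2 * t))"

lemma C1_deriv_smooth_step: "C1_deriv smooth_step smooth_step'"
proof -
  have "((\<lambda>t. 1 - (max 0 t)\<^sup>2) has_real_derivative - (2 * max 0 t)) (at t)" for t :: real
    using DERIV_diff[OF DERIV_const[of 1] DERIV_max_0_square] by simp
  then have "(smooth_step has_real_derivative smooth_step' t) (at t)" for t
    using DERIV_diff[OF DERIV_const[of 1] DERIV_chain2[OF DERIV_max_0_square]]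
    unfolding smooth_step_def[abs_def] smooth_step'_def by fastforce
  then show ?thesis
    unfolding C1_deriv_def smooth_step'_def[abs_def]
    by (auto intro!: continuous_intros)
qed

lemma C1_deriv_smooth_bump: "C1_deriv smooth_bump smooth_bump'"
proof -
  have "((\<lambda>t. 1 - t\<^sup>2) has_real_derivative - (2 * t)) (at t)" for t :: real
    by (auto intro!: derivative_eq_intros)
  then have "(smooth_bump has_real_derivative smooth_bump' t) (at t)" for t
    using DERIV_chain2[OF DERIV_max_0_square]
    unfolding smooth_bump_def[abs_def] smooth_bump'_def by fastforce
  then show ?thesis
    unfolding C1_deriv_def smooth_bump'_def[abs_def]
    by (auto intro!: continuous_intros)
qed

lemma smooth_step_bounds:
  "0 \<le> smooth_step t" "smooth_step t \<le> 1" "\<bar>smooth_step' t\<bar> \<le> 4"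
  "t \<le> 0 \<Longrightarrow> smooth_step t = 0" "t \<ge> 1 \<Longrightarrow> smooth_step t = 1"
  "t \<le> 0 \<or> t \<ge> 1 \<Longrightarrow> smooth_step' t = 0"
proof -
  let ?y = "max 0 (1 - (max 0 t)\<^sup>2)"
  have y: "0 \<le> ?y" "?y \<le> 1" by auto
  have y1: "t \<ge> 1 \<Longrightarrow> ?y = 0" by simp
  show "0 \<le> smooth_step t" "smooth_step t \<le> 1"
    using y by (auto simp: smooth_step_def power_le_one)
  show "t \<le> 0 \<Longrightarrow> smooth_step t = 0" by (simp add: smooth_step_def)
  show "t \<ge> 1 \<Longrightarrow> smooth_step t = 1" using y1 by (simp add: smooth_step_def)
  show z: "t \<le> 0 \<or> t \<ge> 1 \<Longrightarrow> smooth_step' t = 0" using y1 by (auto simp: smooth_step'_def)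
  show "\<bar>smooth_step' t\<bar> \<le> 4"
  proof (cases "t \<le> 0 \<or> t \<ge> 1")
    case False
    then have "?y * max 0 t \<le> 1 * 1" using y by (intro mult_mono) auto
    moreover have "0 \<le> ?y * max 0 t" by simp
    moreover have "smooth_step' t = 4 * (?y * max 0 t)" by (simp add: smooth_step'_def)
    moreover have "\<bar>4 * w\<bar> \<le> 4" if "w \<le> 1 * 1" "0 \<le> w" for w :: real using that by simp
    ultimately show ?thesis by metis
  qed (use z in simp)
qed

lemma smooth_bump_bounds:
  "0 \<le> smooth_bump t" "smooth_bump t \<le> 1" "\<bar>smooth_bump' t\<bar> \<le> 4"
  "\<bar>t\<bar> \<ge> 1 \<Longrightarrow> smooth_bump t = 0" "\<bar>t\<bar> \<ge> 1 \<Longrightarrow> smooth_bump' t = 0"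
  "\<bar>t\<bar> \<le> 1 / 2 \<Longrightarrow> smooth_bump t \<ge> 1 / 2"
proof -
  let ?y = "max 0 (1 - t\<^sup>2)"
  have y: "0 \<le> ?y" "?y \<le> 1" by auto
  have y1: "\<bar>t\<bar> \<ge> 1 \<Longrightarrow> ?y = 0" by (simp add: abs_le_square_iff[of 1, simplified])
  show "0 \<le> smooth_bump t" "smooth_bump t \<le> 1"
    using y by (auto simp: smooth_bump_def power_le_one)
  show "\<bar>t\<bar> \<ge> 1 \<Longrightarrow> smooth_bump t = 0" using y1 by (simp add: smooth_bump_def)
  show z: "\<bar>t\<bar> \<ge> 1 \<Longrightarrow> smooth_bump' t = 0" using y1 by (simp add: smooth_bump'_def)
  show "\<bar>smooth_bump' t\<bar> \<le> 4"
  proof (cases "\<bar>t\<bar> \<ge> 1")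
    case False
    then have "?y * \<bar>t\<bar> \<le> 1 * 1" using y by (intro mult_mono) auto
    then show ?thesis using y by (simp add: smooth_bump'_def abs_mult)
  qed (use z in simp)
  assume "\<bar>t\<bar> \<le> 1 / 2"
  then have "t\<^sup>2 \<le> (1 / 2)\<^sup>2" by (simp add: abs_le_square_iff[symmetric])
  \<comment> \<open>Hence the bump is at least 9/16 on the middle half of its support.\<close>
  then have "3 / 4 \<le> ?y" by (simp add: power2_eq_square)
  then have "(3 / 4)\<^sup>2 \<le> smooth_bump t" unfolding smooth_bump_def by (rule power_mono) simp
  then show "smooth_bump t \<ge> 1 / 2" by (simp add: power2_eq_square)
qed

section \<open>What the two profiles yield\<close>

text \<open>The witness is |x|^(-m), cut off to a neighbourhood of infinity for \<sigma> = 1 and of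
  the origin for \<sigma> = -1.\<close>

lemma not_subset_smooth_step:
  fixes a b c p q r m \<sigma> :: real
  defines "N \<equiv> real DIM('a::euclidean_space)"
  assumes pos: "p > 0" "q > 0" "r > 0" and \<sigma>: "\<bar>\<sigma>\<bar> = 1"
    and a: "\<sigma> * (a + N - m * q) < 0" and b: "\<sigma> * (b - p + N - m * p) < 0 \<or> m = 0"
    and c: "\<sigma> * (c + N - m * r) \<ge> 0"
  shows "\<not> (Wsp a b q p :: ('a \<Rightarrow> real) set) \<subseteq> Lset c r
    \<and> \<not> (Wtsp a b q p :: ('a \<Rightarrow> real) set) \<subseteq> Lset c r"
proof -
  define v where "v t = exp (- m * t) * smooth_step (\<sigma> * t + 0)" for t
  define v' where "v' t = exp (- m * t) * (\<sigma> * smooth_step' (\<sigma> * t + 0) - m * smooth_step (\<sigma> * t + 0))" for t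
  have C1: "C1_deriv v v'"
    unfolding v_def[abs_def] v'_def[abs_def] by (rule C1_deriv_exp_mult_compose[OF C1_deriv_smooth_step])
  have v: "\<bar>v t\<bar> \<le> 1 * exp (- m * t)" for t
    using smooth_step_bounds(1,2)[of "\<sigma> * t"] by (simp add: v_def)
  have v': "\<bar>v' t\<bar> \<le> (4 + \<bar>m\<bar>) * exp (- m * t)" for t
  proof -
    have "\<bar>\<sigma> * smooth_step' (\<sigma> * t) - m * smooth_step (\<sigma> * t)\<bar>
        \<le> \<bar>\<sigma> * smooth_step' (\<sigma> * t)\<bar> + \<bar>m * smooth_step (\<sigma> * t)\<bar>" by (rule abs_triangle_ineq4)
    also have "\<dots> \<le> 4 + \<bar>m\<bar>"
      using smooth_step_bounds(1-3)[of "\<sigma> * t"] \<sigma>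
      by (intro add_mono) (simp_all add: abs_mult mult_left_le)
    finally show ?thesis by (simp add: v'_def abs_mult)
  qed
  have "logint (a + N) q v < \<infinity>"
    by (rule logint_half_line_finite[where m = m, OF pos(2) _ \<sigma> a v]) (auto simp: v_def smooth_step_bounds)
  moreover have "logint (b - p + N) p v' < \<infinity>"
    using b
  proof
    assume "\<sigma> * (b - p + N - m * p) < 0"
    then show ?thesis
      by (rule_tac logint_half_line_finite[where m = m, OF pos(1) _ \<sigma> _ v']) (auto simp: v'_def smooth_step_bounds)
  next
    \<comment> \<open>The profile is now constant on both sides of [-1,1], so v' lives in that
      interval and its norm is finite for every b.\<close>
    assume m: "m = 0"
    have out: "v' t = 0" if "\<bar>t - 0\<bar> > 1" for t
    proof -
      have "\<bar>\<sigma> * t\<bar> > 1" using that \<sigma> by (simp add: abs_mult)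
      then have "\<sigma> * t \<le> 0 \<or> \<sigma> * t \<ge> 1" by linarith
      then show ?thesis by (simp add: v'_def m smooth_step_bounds(6))
    qed
    show ?thesis
      by (rule le_less_trans[OF logint_exp_le[where L = 1 and \<tau> = 0, OF pos(1) _ _ v' out]]) auto
  qed
  moreover have "logint (c + N) r v = \<infinity>"
    by (rule logint_half_line_infinite[where m = m, OF pos(3) \<sigma> c]) (auto simp: v_def smooth_step_bounds)
  ultimately show ?thesis
    using not_subset_log_radial[where 'a = 'a, OF C1, folded N_def] by simp
qed

text \<open>The left side is free of \<tau> because m makes the target weight critical. In the
  gradient term, 4/L comes from differentiating the rescaled bump and |m| from differentiating e^(-m
  t).\<close>

lemma emb_smooth_bump:
  fixes a b c p q r :: real
  defines "N \<equiv> real DIM('a::euclidean_space)"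
  assumes emb: "emb_W TYPE('a) a b q p c r \<or> emb_Wt TYPE('a) a b q p c r"
    and pos: "p > 0" "q > 0" "r > 0"
  defines "m \<equiv> (c + N) / r"
  defines "\<alpha> \<equiv> a + N - m * q" and "\<beta> \<equiv> b - p + N - m * p"
  obtains C where "C \<ge> 0"
    "\<And>L \<tau>. L > 0 \<Longrightarrow> L powr (1 / r) \<le> C * (L powr (1 / q) * exp ((\<alpha> * \<tau> + \<bar>\<alpha>\<bar> * L) / q)
        + (4 / L + \<bar>m\<bar>) * L powr (1 / p) * exp ((\<beta> * \<tau> + \<bar>\<beta>\<bar> * L) / p))"
proof -
  obtain C where "C \<ge> 0" and C:
    "\<And>v v'. C1_deriv v v' \<Longrightarrow> logint (a + N) q v < \<infinity> \<Longrightarrow> logint (b - p + N) p v' < \<infinity> \<Longrightarrow>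
       logint (c + N) r v < \<infinity> \<and>
       enn2real (logint (c + N) r v) powr (1 / r)
         \<le> C * (enn2real (logint (a + N) q v) powr (1 / q) + enn2real (logint (b - p + N) p v') powr (1 / p))"
    using emb_log_radial[OF emb, folded N_def] by blast
  have mr: "m * r = c + N" using pos by (simp add: m_def)
  \<comment> \<open>Absorbs the factors 2^(1/q) and 2^(1/p) due to the support having length
    2L.\<close>
  define M where "M = max (2 powr (1 / q)) (2 powr (1 / p))"
  have M: "M \<ge> 0" by (auto simp: M_def le_max_iff_disj)
  have main: "L powr (1 / r) \<le> 2 * C * M * (L powr (1 / q) * exp ((\<alpha> * \<tau> + \<bar>\<alpha>\<bar> * L) / q)
        + (4 / L + \<bar>m\<bar>) * L powr (1 / p) * exp ((\<beta> * \<tau> + \<bar>\<beta>\<bar> * L) / p))" if L: "L > 0" for L \<tau>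
  proof -
    define X Y where "X = L powr (1 / q) * exp ((\<alpha> * \<tau> + \<bar>\<alpha>\<bar> * L) / q)"
      and "Y = (4 / L + \<bar>m\<bar>) * L powr (1 / p) * exp ((\<beta> * \<tau> + \<bar>\<beta>\<bar> * L) / p)"
    have XY: "X \<ge> 0" "Y \<ge> 0" using L by (simp_all add: X_def Y_def)
    let ?s = "\<lambda>t. 1 / L * t + - \<tau> / L"
    have s: "?s t = (t - \<tau>) / L" for t by (simp add: diff_divide_distrib)
    define v where "v t = exp (- m * t) * smooth_bump (?s t)" for t
    define v' where "v' t = exp (- m * t) * (1 / L * smooth_bump' (?s t) - m * smooth_bump (?s t))" for t
    have C1: "C1_deriv v v'"
      unfolding v_def[abs_def] v'_def[abs_def] by (rule C1_deriv_exp_mult_compose[OF C1_deriv_smooth_bump])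
    have v: "\<bar>v t\<bar> \<le> 1 * exp (- m * t)" for t
      using smooth_bump_bounds(1,2)[of "?s t"] by (simp add: v_def)
    have v': "\<bar>v' t\<bar> \<le> (4 / L + \<bar>m\<bar>) * exp (- m * t)" for t
    proof -
      have "\<bar>1 / L * smooth_bump' (?s t) - m * smooth_bump (?s t)\<bar>
          \<le> \<bar>1 / L * smooth_bump' (?s t)\<bar> + \<bar>m * smooth_bump (?s t)\<bar>" by (rule abs_triangle_ineq4)
      also have "\<dots> \<le> 4 / L + \<bar>m\<bar>"
        using smooth_bump_bounds(1-3)[of "?s t"] L
        by (intro add_mono) (simp_all add: abs_mult mult_left_le divide_right_mono)
      finally show ?thesis unfolding v'_def by (simp add: abs_mult)
    qed
    have out: "v t = 0" "v' t = 0" if "\<bar>t - \<tau>\<bar> > L" for t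
    proof -
      have "\<bar>?s t\<bar> \<ge> 1" unfolding s using that L by (simp add: abs_divide)
      then show "v t = 0" "v' t = 0" by (simp_all only: v_def v'_def smooth_bump_bounds(4,5)) simp_all
    qed
    have low: "\<bar>v t\<bar> \<ge> 1 / 2 * exp (- m * t)" if "\<bar>t - \<tau>\<bar> \<le> L / 2" for t
    proof -
      have "\<bar>?s t\<bar> \<le> 1 / 2" unfolding s using that L by (simp add: abs_divide field_simps)
      from smooth_bump_bounds(6)[OF this] show ?thesis by (simp add: v_def abs_mult)
    qed
    have K: "0 \<le> 4 / L + \<bar>m\<bar>" "(0::real) \<le> 1" using L by auto
    have qa: "logint (a + N) q v \<le> ennreal (1 powr q * (2 * L) * exp (\<alpha> * \<tau> + \<bar>\<alpha>\<bar> * L))"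
      unfolding \<alpha>_def by (rule logint_exp_le[OF pos(2) K(2) L v out(1)])
    have pb: "logint (b - p + N) p v' \<le> ennreal ((4 / L + \<bar>m\<bar>) powr p * (2 * L) * exp (\<beta> * \<tau> + \<bar>\<beta>\<bar> * L))"
      unfolding \<beta>_def by (rule logint_exp_le[OF pos(1) K(1) L v' out(2)])
    have rc: "ennreal ((1 / 2) powr r * (2 * (L / 2))) \<le> logint (c + N) r v"
      unfolding mr[symmetric] by (rule logint_exp_ge[OF pos(3)]) (use L low in auto)
    have fin: "logint (a + N) q v < \<infinity>" "logint (b - p + N) p v' < \<infinity>"
      using qa pb by (auto intro: le_less_trans)
    note ineq = C[OF C1 fin]
    \<comment> \<open>The bump is at least 1/2 on an interval of length L. The powers r and 1/r
      cancel on that 1/2, which becomes the factor 2 in the final constant.\<close>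
    have "1 / 2 * L powr (1 / r) = ((1 / 2) powr r * (2 * (L / 2))) powr (1 / r)"
      using L pos by (simp add: powr_mult powr_powr)
    also have "\<dots> \<le> enn2real (logint (c + N) r v) powr (1 / r)"
    proof (rule powr_mono2)
      have "enn2real (ennreal ((1 / 2) powr r * (2 * (L / 2)))) \<le> enn2real (logint (c + N) r v)"
        using ineq by (intro enn2real_mono[OF rc]) auto
      then show "(1 / 2) powr r * (2 * (L / 2)) \<le> enn2real (logint (c + N) r v)"
        using L by (subst (asm) enn2real_ennreal) auto
    qed (use L pos in auto)
    also have "\<dots> \<le> C * (enn2real (logint (a + N) q v) powr (1 / q) + enn2real (logint (b - p + N) p v') powr (1 / p))"
      using ineq by simp
    also have "\<dots> \<le> C * (M * X + M * Y)"
    proof (intro mult_left_mono[OF _ \<open>C \<ge> 0\<close>] add_mono)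
      have "enn2real (logint (a + N) q v) powr (1 / q) \<le> (1 powr q * (2 * L) * exp (\<alpha> * \<tau> + \<bar>\<alpha>\<bar> * L)) powr (1 / q)"
        using L pos by (intro powr_mono2 enn2real_leI qa) auto
      also have "\<dots> = 2 powr (1 / q) * X"
        using L by (simp add: X_def powr_mult powr_def[of "exp _"])
      also have "\<dots> \<le> M * X" using XY by (intro mult_right_mono) (simp_all add: M_def)
      finally show "enn2real (logint (a + N) q v) powr (1 / q) \<le> M * X" .
      have "enn2real (logint (b - p + N) p v') powr (1 / p)
          \<le> ((4 / L + \<bar>m\<bar>) powr p * (2 * L) * exp (\<beta> * \<tau> + \<bar>\<beta>\<bar> * L)) powr (1 / p)"
        using L pos by (intro powr_mono2 enn2real_leI pb) auto
      also have "\<dots> = 2 powr (1 / p) * Y"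
        using L K pos by (simp add: Y_def powr_mult powr_powr powr_def[of "exp _"])
      also have "\<dots> \<le> M * Y" using XY by (intro mult_right_mono) (simp_all add: M_def)
      finally show "enn2real (logint (b - p + N) p v') powr (1 / p) \<le> M * Y" .
    qed
    finally have "L powr (1 / r) \<le> 2 * C * M * (X + Y)" by (simp add: algebra_simps)
    then show ?thesis by (simp only: X_def Y_def)
  qed
  show thesis
    by (rule that[OF _ main]) (use \<open>C \<ge> 0\<close> M in auto)
qed

section \<open>Limits in \<tau> and L, and the six cases\<close>

text \<open>Along \<tau> = -n/\<gamma> the exponential tends to 0 whatever the sign of \<gamma>;
  this removes a noncritical term.\<close>

lemma le_of_le_add_exp:
  fixes x y z :: real
  assumes "\<gamma> \<noteq> 0" "s > 0" "\<And>\<tau>. x \<le> y + z * exp ((\<gamma> * \<tau> + \<delta>) / s)"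
  shows "x \<le> y"
proof (rule LIMSEQ_le_const)
  have "filterlim (\<lambda>n. - (1 / s) * real n) at_bot sequentially"
    using assms(2)
    by (intro filterlim_tendsto_neg_mult_at_bot[OF tendsto_const _ filterlim_real_sequentially]) auto
  then have "(\<lambda>n. exp (- (1 / s) * real n)) \<longlonglongrightarrow> 0"
    by (rule filterlim_compose[OF exp_at_bot])
  then have "(\<lambda>n. y + z * (exp (\<delta> / s) * exp (- (1 / s) * real n))) \<longlonglongrightarrow> y + z * (exp (\<delta> / s) * 0)"
    by (intro tendsto_intros)
  then show "(\<lambda>n. y + z * (exp (\<delta> / s) * exp (- (1 / s) * real n))) \<longlonglongrightarrow> y" by simp
  have "x \<le> y + z * (exp (\<delta> / s) * exp (- (1 / s) * real n))" for n
  proof -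
    have "(\<gamma> * (- real n / \<gamma>) + \<delta>) / s = \<delta> / s + - (1 / s) * real n"
      using assms(1) by (simp add: diff_divide_distrib)
    then show ?thesis
      using assms(3)[of "- real n / \<gamma>"] by (simp only: exp_add)
  qed
  then show "\<exists>n0. \<forall>n\<ge>n0. x \<le> y + z * (exp (\<delta> / s) * exp (- (1 / s) * real n))"
    by blast
qed

lemma powr_not_bounded:
  fixes x y :: real
  assumes "x > y" "\<And>L. L \<ge> 1 \<Longrightarrow> L powr x \<le> K * L powr y"
  shows False
proof -
  \<comment> \<open>Chosen so that L^(x-y) = |K| + 1, which exceeds K.\<close>
  define L where "L = (\<bar>K\<bar> + 1) powr (1 / (x - y))"
  have L: "L \<ge> 1" using assms(1) by (auto simp: L_def intro!: ge_one_powr_ge_zero)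
  have "L powr x = L powr (x - y) * L powr y" by (simp flip: powr_add)
  then have "L powr (x - y) * L powr y \<le> K * L powr y" using assms(2)[OF L] by simp
  then have "L powr (x - y) \<le> K" using L by simp
  moreover have "L powr (x - y) = \<bar>K\<bar> + 1" using assms(1) by (simp add: L_def powr_powr)
  ultimately show False by simp
qed

theorem theorem2p1:
  fixes a b c p q r :: real
  defines "N \<equiv> real DIM('a::euclidean_space)"
  defines "c0 \<equiv> r * (a + N) / q - N"
  defines "c1 \<equiv> r * (b - p + N) / p - N"
  assumes "1 \<le> p" and "0 < q" and "0 < r"
  shows "((c < min c0 c1 \<or> c > max c0 c1)
          \<or> ((b - p \<le> - N \<and> - N < a \<or> b - p \<ge> - N \<and> - N > a)
             \<and> \<not> (min c0 (- N) \<le> c \<and> c \<le> max c0 (- N) \<and> c \<noteq> - N))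
         \<longrightarrow> \<not> ((Wsp a b q p :: ('a \<Rightarrow> real) set) \<subseteq> Lset c r)
             \<and> \<not> ((Wtsp a b q p :: ('a \<Rightarrow> real) set) \<subseteq> Lset c r))
     \<and> (((a + N) / q \<noteq> (b - p + N) / p \<and> c = c0 \<and> r \<noteq> q)
          \<or> ((a + N) / q \<noteq> (b - p + N) / p \<and> c = c1 \<and> r < p)
          \<or> ((a + N) / q = (b - p + N) / p \<and> r < min p q \<and> c = c0)
          \<or> (a = - N \<and> b = p - N \<and> r < q \<and> c = c0)
         \<longrightarrow> \<not> emb_W TYPE('a) a b q p c r \<and> \<not> emb_Wt TYPE('a) a b q p c r)"
proof -
  have p: "p > 0" using \<open>1 \<le> p\<close> by simp
  note pos = p \<open>0 < q\<close> \<open>0 < r\<close>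
  define m where "m = (c + N) / r"
  have cm: "c + N - m * r = 0" using pos by (simp add: m_def)
  have nosub: "\<not> ((Wsp a b q p :: ('a \<Rightarrow> real) set) \<subseteq> Lset c r)
      \<and> \<not> ((Wtsp a b q p :: ('a \<Rightarrow> real) set) \<subseteq> Lset c r)"
    if "\<bar>\<sigma>\<bar> = 1" "\<sigma> * (a + N - \<mu> * q) < 0" "\<sigma> * (b - p + N - \<mu> * p) < 0 \<or> \<mu> = 0"
      "\<sigma> * (c + N - \<mu> * r) \<ge> 0" for \<sigma> \<mu>
    using not_subset_smooth_step[where 'a = 'a, folded N_def, OF pos that] .
  have part1: "\<not> ((Wsp a b q p :: ('a \<Rightarrow> real) set) \<subseteq> Lset c r)
      \<and> \<not> ((Wtsp a b q p :: ('a \<Rightarrow> real) set) \<subseteq> Lset c r)"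
    if out: "c < min c0 c1 \<or> c > max c0 c1"
  proof -
    have q: "c < c0 \<longleftrightarrow> m * q < a + N" "c0 < c \<longleftrightarrow> a + N < m * q"
      using pos by (auto simp: c0_def m_def field_simps)
    have p: "c < c1 \<longleftrightarrow> m * p < b - p + N" "c1 < c \<longleftrightarrow> b - p + N < m * p"
      using pos by (auto simp: c1_def m_def field_simps)
    from out show ?thesis
    proof
      \<comment> \<open>Both source exponents are positive, so |x|^(-m) near the origin has finite
        norms there; for c above both values the same power is used at infinity.\<close>
      assume "c < min c0 c1"
      then show ?thesis using q p cm by (intro nosub[of "-1" m]) auto
    next
      assume "c > max c0 c1"
      then show ?thesis using q p cm by (intro nosub[of 1 m]) auto
    qed
  qed
  have part2: "\<not> ((Wsp a b q p :: ('a \<Rightarrow> real) set) \<subseteq> Lset c r)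
      \<and> \<not> ((Wtsp a b q p :: ('a \<Rightarrow> real) set) \<subseteq> Lset c r)"
    if ab: "b - p \<le> - N \<and> - N < a \<or> b - p \<ge> - N \<and> - N > a"
      and out: "\<not> (min c0 (- N) \<le> c \<and> c \<le> max c0 (- N) \<and> c \<noteq> - N)"
    using ab
  proof
    assume ab: "b - p \<le> - N \<and> - N < a"
    then have "r * (b - p + N) \<le> 0" "r * (a + N) > 0"
      using pos by (auto simp: mult_le_0_iff)
    then have *: "c1 \<le> - N" "- N < c0"
      using pos by (auto simp: c1_def c0_def divide_le_0_iff)
    \<comment> \<open>For c \<le> -N a function constant near the origin works: |x|^a is integrable
      there and |x|^c is not. For c > -N the hypothesis forces c > c0, which is case (i). The other
      half of (ii) is the same at infinity.\<close>
    show ?thesis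
    proof (cases "c \<le> - N")
      case True
      then show ?thesis using ab by (intro nosub[of "-1" 0]) auto
    next
      case False
      with * out show ?thesis by (intro part1) auto
    qed
  next
    assume ab: "b - p \<ge> - N \<and> - N > a"
    then have "r * (b - p + N) \<ge> 0" "r * (a + N) < 0"
      using pos by (auto simp: mult_less_0_iff)
    then have *: "c1 \<ge> - N" "- N > c0"
      using pos by (auto simp: c1_def c0_def divide_less_0_iff)
    show ?thesis
    proof (cases "c \<ge> - N")
      case True
      then show ?thesis using ab by (intro nosub[of 1 0]) auto
    next
      case False
      with * out show ?thesis by (intro part1) auto
    qed
  qed
  have part3: False
    if emb: "emb_W TYPE('a) a b q p c r \<or> emb_Wt TYPE('a) a b q p c r"
      and cases: "((a + N) / q \<noteq> (b - p + N) / p \<and> c = c0 \<and> r \<noteq> q)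
          \<or> ((a + N) / q \<noteq> (b - p + N) / p \<and> c = c1 \<and> r < p)
          \<or> ((a + N) / q = (b - p + N) / p \<and> r < min p q \<and> c = c0)
          \<or> (a = - N \<and> b = p - N \<and> r < q \<and> c = c0)"
  proof -
    define \<alpha> \<beta> where "\<alpha> = a + N - m * q" and "\<beta> = b - p + N - m * p"
    have \<alpha>: "\<alpha> = 0 \<longleftrightarrow> m = (a + N) / q" and \<beta>: "\<beta> = 0 \<longleftrightarrow> m = (b - p + N) / p"
      using pos by (auto simp: \<alpha>_def \<beta>_def field_simps)
    have m0: "m = (a + N) / q" if "c = c0" using that pos by (simp add: m_def c0_def)
    have m1: "m = (b - p + N) / p" if "c = c1" using that pos by (simp add: m_def c1_def)
    obtain C where C: "C \<ge> 0"
      "\<And>L \<tau>. L > 0 \<Longrightarrow> L powr (1 / r) \<le> C * (L powr (1 / q) * exp ((\<alpha> * \<tau> + \<bar>\<alpha>\<bar> * L) / q)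
        + (4 / L + \<bar>m\<bar>) * L powr (1 / p) * exp ((\<beta> * \<tau> + \<bar>\<beta>\<bar> * L) / p))"
      unfolding \<alpha>_def \<beta>_def m_def
      using emb_smooth_bump[where 'a = 'a, folded N_def, OF emb pos] by blast
    \<comment> \<open>For L \<ge> 1 the gradient term grows at most like L^(1/p).\<close>
    have big: "C * ((4 / L + \<bar>m\<bar>) * L powr (1 / p)) \<le> C * (4 + \<bar>m\<bar>) * L powr (1 / p)" if "L \<ge> 1" for L
    proof -
      have "4 / L \<le> 4" using that by (simp add: field_simps)
      then have "(4 / L + \<bar>m\<bar>) * L powr (1 / p) \<le> (4 + \<bar>m\<bar>) * L powr (1 / p)"
        by (intro mult_right_mono) auto
      then show ?thesis using C(1) by (simp add: mult_left_mono mult.assoc)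
    qed
    consider (iii) "\<alpha> = 0" "\<beta> \<noteq> 0" "r \<noteq> q" | (iv) "\<alpha> \<noteq> 0" "\<beta> = 0" "r < p"
      | (v) "\<alpha> = 0" "\<beta> = 0" "r < p" "r < q" | (vi) "\<alpha> = 0" "\<beta> = 0" "m = 0" "r < q"
      using cases m0 m1 \<alpha> \<beta> by fastforce
    then show False
    proof cases
      case iii
      \<comment> \<open>The gradient term disappears as \<tau> moves off. What remains holds for all
        L > 0, so large L excludes r < q and small L excludes r > q.\<close>
      have le: "L powr (1 / r) \<le> C * L powr (1 / q)" if "L > 0" for L
      proof (rule le_of_le_add_exp[OF iii(2) pos(1)])
        show "L powr (1 / r) \<le> C * L powr (1 / q)
          + C * ((4 / L + \<bar>m\<bar>) * L powr (1 / p)) * exp ((\<beta> * \<tau> + \<bar>\<beta>\<bar> * L) / p)" for \<tau>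
          using C(2)[OF that, of \<tau>] iii(1) by (simp add: algebra_simps)
      qed
      show False
      proof (cases "r < q")
        case True
        then have "1 / q < 1 / r" using pos by (simp add: field_simps)
        then show False using le by (rule powr_not_bounded) simp
      next
        case False
        with iii(3) have "- (1 / r) > - (1 / q)" using pos by (simp add: field_simps)
        \<comment> \<open>Replacing L by 1/L turns the limit at 0 into one at infinity.\<close>
        moreover have "L powr - (1 / r) \<le> C * L powr - (1 / q)" if "L \<ge> 1" for L
          using le[of "1 / L"] that by (simp add: powr_divide powr_minus_divide)
        ultimately show False by (rule powr_not_bounded)
      qed
    next
      case iv
      have le: "L powr (1 / r) \<le> C * ((4 / L + \<bar>m\<bar>) * L powr (1 / p))" if "L > 0" for L
      proof (rule le_of_le_add_exp[OF iv(1) pos(2)])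
        show "L powr (1 / r) \<le> C * ((4 / L + \<bar>m\<bar>) * L powr (1 / p))
          + C * L powr (1 / q) * exp ((\<alpha> * \<tau> + \<bar>\<alpha>\<bar> * L) / q)" for \<tau>
          using C(2)[OF that, of \<tau>] iv(2) by (simp add: algebra_simps)
      qed
      have "1 / p < 1 / r" using iv(3) pos by (simp add: field_simps)
      \<comment> \<open>Only large L helps here: for small L the factor 4/L makes the right side
        large.\<close>
      moreover have "L powr (1 / r) \<le> C * (4 + \<bar>m\<bar>) * L powr (1 / p)" if "L \<ge> 1" for L
        using le[of L] big[OF that] that by linarith
      ultimately show False by (rule powr_not_bounded)
    next
      case v
      have "1 / min p q < 1 / r" using v pos by (simp add: field_simps min_def)
      moreover have "L powr (1 / r) \<le> (C * (5 + \<bar>m\<bar>)) * L powr (1 / min p q)" if "L \<ge> 1" for L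
      proof -
        have "L powr (1 / r) \<le> C * L powr (1 / q) + C * (4 + \<bar>m\<bar>) * L powr (1 / p)"
        proof -
          have "L powr (1 / r) \<le> C * L powr (1 / q) + C * ((4 / L + \<bar>m\<bar>) * L powr (1 / p))"
            \<comment> \<open>Both exponents are critical, so \<tau> has no influence and is set to
              0.\<close>
            using C(2)[of L 0] v(1,2) that by (simp add: distrib_left)
          then show ?thesis using big[OF that] by linarith
        qed
        also have "\<dots> \<le> C * L powr (1 / min p q) + C * (4 + \<bar>m\<bar>) * L powr (1 / min p q)"
          using that pos C(1) by (intro add_mono mult_left_mono powr_mono) (auto simp: field_simps min_def)
        finally show ?thesis by (simp add: algebra_simps)
      qed
      ultimately show False by (rule powr_not_bounded)
    next
      case vi
      have "1 / q < 1 / r" using vi(4) pos by (simp add: field_simps)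
      moreover have "L powr (1 / r) \<le> (5 * C) * L powr (1 / q)" if "L \<ge> 1" for L
      proof -
        \<comment> \<open>With m = 0 the gradient term is 4 L^(1/p - 1), bounded for L \<ge> 1
          because p \<ge> 1. The function term L^(1/q) dominates, so r < q alone gives the
          contradiction.\<close>
        have "L powr (1 / p) \<le> L powr 1"
          using that \<open>1 \<le> p\<close> by (intro powr_mono) auto
        then have "4 / L * L powr (1 / p) \<le> 4 * L powr 0"
          using that by (simp add: field_simps)
        also have "\<dots> \<le> 4 * L powr (1 / q)"
          using that pos by (intro mult_left_mono powr_mono) auto
        finally have "L powr (1 / q) + 4 / L * L powr (1 / p) \<le> 5 * L powr (1 / q)" by simp
        from mult_left_mono[OF this C(1)] show ?thesis
          using C(2)[of L 0] vi(1-3) that by simp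
      qed
      ultimately show False by (rule powr_not_bounded)
    qed
  qed
  show ?thesis using part1 part2 part3 by blast
qed

end
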